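(* Let $K$ be an oriented twisted knot diagram such that every classical crossing $c$ of $K$ satisfies one of the following conditions: (i) $c\notin ZC(K)$, i.e. $ind^{\,0}(c,K)$ is odd; (ii) $c\in ZC(K)$ and $zind^{\,0}(c,K)$ is odd. Then $K$ does not admit a cosmetic crossing change.
   Context: Twisted knot diagrams. An oriented twisted knot diagram $K$ is a generic immersed oriented closed curve in $\mathbb{R}^2$ with finitely many transverse double points, each marked either as a classical crossing (with over/under information) or as a virtual crossing (no over/under information), together with finitely many bars (short transverse marks) on the curve away from the double points. Diagrams are considered up to planar isotopy. $C(K)$ is the set of classical crossings and $sgn(c)=sign(c)\in\{+1,-1\}$ is the usual sign of $c\in C(K)$. The oriented twisted knot type of a diagram is its equivalence class under the Reidemeister moves $C_1,C_2,C_3,V_1,V_2,V_3,V_4,T_1,T_2,T_3$. Reidemeister moves. $C_1,C_2,C_3$ are the usual classical Reidemeister moves; $V_1,V_2,V_3$ are the same moves with all crossings virtual; $V_4$ moves an arc having two consecutive virtual crossings across a classical crossing. $T_1$ inserts or deletes two adjacent bars on an arc. $T_2$ slides a bar along its strand through a virtual crossing. $T_3$ replaces a classical crossing $c$ having a bar on each of its four adjacent arcs (one before and one after $c$ on each strand) by a bar-free tangle with the same end points and the same connectivity in which the two strands cross first virtually, then at one classical crossing $c'$, then again virtually; the strand that is over at $c$ is under at $c'$, and $sgn(c')=sgn(c)$. All orientations are allowed. Cosmetic crossings. A crossing change at $c\in C(K)$ exchanges the over and under strands at $c$ and leaves the rest of the diagram unchanged. A crossing is nugatory if there is a circle in the plane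 of the diagram that meets the diagram transversely at that single crossing and at no other point. A cosmetic crossing is a non-nugatory classical crossing whose crossing change does not change the (oriented twisted) knot type; the corresponding change is a cosmetic crossing change. Smoothing. For $c\in C(K)$, let $K_c$ be the two-component diagram obtained by the oriented smoothing at $c$, its components labelled $0$ and $1$ (the parities of $ind^{\,l}(c,K)$ and $zind^{\,l}(c,K)$ do not depend on which component gets which label). Affine index. For $l\in\{0,1\}$, traverse the $l$-component of $K_c$ once along its orientation starting near $c$, and let $\gamma_1,\dots,\gamma_{k_l}$ be the sequence of classical crossings met (with repetition). Put $\epsilon_i=0$ if the traversal passes under at $\gamma_i$ and $\epsilon_i=1$ if it passes over. Then $ind^{\,l}(c,K)=\sum_{i=1}^{k_l}(-1)^{\epsilon_i}sign(\gamma_i)$. (Self-crossings of the $l$-component contribute zero, and $ind^{\,1}(c,K)=-ind^{\,0}(c,K)$.) Zero crossings. $c\in C(K)$ is a zero crossing if $ind^{\,l}(c,K)$ is even for $l=0$ or $1$ (equivalently both). $ZC(K)$ is the set of zero crossings. For $c\in ZC(K)$ the zero affine index is $zind^{\,l}(c,K)=\sum_{\gamma_i\in ZC(K)}(-1)^{\epsilon_i}sign(\gamma_i)$, the sum being over those terms of the sequence $\gamma_1,\dots,\gamma_{k_l}$ of classical crossings met along the $l$-component of $K_c$ that are zero crossings of $K$. *)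

theory Defs
  imports "HOL-Analysis.Analysis"
begin

section \<open>Closed immersed plane curves\<close>

text \<open>The plane is the type \<^typ>\<open>complex\<close>. A closed oriented curve is given by a map of period 1 on the
  real line; the parameters in \<open>{0..<1}\<close> then run once along the curve.\<close>

definition closed_immersion :: "(real \<Rightarrow> complex) \<Rightarrow> bool" where
  "closed_immersion g \<longleftrightarrow>
     (\<forall>t. g (t + 1) = g t) \<and> g C1_differentiable_on UNIV \<and> (\<forall>t. vector_derivative g (at t) \<noteq> 0)"

definition det2 :: "complex \<Rightarrow> complex \<Rightarrow> real" where
  "det2 u v = Re u * Im v - Im u * Re v"


section \<open>Twisted knot diagrams\<close>

text \<open>A double point is classical if one of its two passages is marked as the over passage, and
  virtual if neither is. The sets \<open>over\<close> and \<open>bars\<close> consist of parameters and have period 1.\<close>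

record tdiagram =
  strand :: "real \<Rightarrow> complex"
  over :: "real set"
  bars :: "real set"

definition passages :: "tdiagram \<Rightarrow> complex \<Rightarrow> real set" where
  "passages K p = {t \<in> {0..<1}. strand K t = p}"

definition double_points :: "tdiagram \<Rightarrow> complex set" where
  "double_points K = {p. \<exists>s \<in> passages K p. \<exists>t \<in> passages K p. s \<noteq> t}"

definition twisted_diagram :: "tdiagram \<Rightarrow> bool" where
  "twisted_diagram K \<longleftrightarrow>
     closed_immersion (strand K) \<and>
     finite (double_points K) \<and>
     (\<forall>p \<in> double_points K. card (passages K p) = 2) \<and>
     (\<forall>p. \<forall>s \<in> passages K p. \<forall>t \<in> passages K p. s \<noteq> t \<longrightarrow>
        det2 (vector_derivative (strand K) (at s)) (vector_derivative (strand K) (at t)) \<noteq> 0) \<and>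
     (\<forall>t. t + 1 \<in> over K \<longleftrightarrow> t \<in> over K) \<and>
     (\<forall>t \<in> over K. strand K t \<in> double_points K) \<and>
     (\<forall>p. \<forall>s \<in> passages K p \<inter> over K. \<forall>t \<in> passages K p \<inter> over K. s = t) \<and>
     (\<forall>t. t + 1 \<in> bars K \<longleftrightarrow> t \<in> bars K) \<and>
     finite (bars K \<inter> {0..<1}) \<and>
     (\<forall>t \<in> bars K. strand K t \<notin> double_points K)"

definition classical_crossings :: "tdiagram \<Rightarrow> complex set" where
  "classical_crossings K = {c \<in> double_points K. \<exists>t \<in> passages K c. t \<in> over K}"

definition over_time :: "tdiagram \<Rightarrow> complex \<Rightarrow> real" where
  "over_time K c = (THE t. t \<in> passages K c \<and> t \<in> over K)"

definition under_time :: "tdiagram \<Rightarrow> complex \<Rightarrow> real" where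
  "under_time K c = (THE t. t \<in> passages K c \<and> t \<notin> over K)"

text \<open>A classical crossing is positive if the over strand has to be turned anticlockwise (by less
  than a half turn) to reach the direction of the under strand.\<close>

definition csign :: "tdiagram \<Rightarrow> complex \<Rightarrow> int" where
  "csign K c =
     (if 0 < det2 (vector_derivative (strand K) (at (over_time K c)))
                  (vector_derivative (strand K) (at (under_time K c))) then 1 else - 1)"


section \<open>Affine index, zero crossings, zero affine index\<close>

text \<open>The oriented smoothing at \<open>c\<close> cuts the closed curve at its two passages through \<open>c\<close>. The
  labels are fixed as follows: the 0-component runs from the over passage of \<open>c\<close> to the next under
  passage, the 1-component from the under passage to the next over passage. A component is
  represented by the open parameter interval on which the curve traverses it.\<close>

definition next_time :: "real \<Rightarrow> real \<Rightarrow> real" where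
  "next_time s t = (if s < t then t else t + 1)"

definition component_params :: "tdiagram \<Rightarrow> complex \<Rightarrow> nat \<Rightarrow> real set" where
  "component_params K c l =
     (if l = 0 then {over_time K c <..< next_time (over_time K c) (under_time K c)}
      else {under_time K c <..< next_time (under_time K c) (over_time K c)})"

definition eps :: "tdiagram \<Rightarrow> real \<Rightarrow> nat" where
  "eps K t = (if t \<in> over K then 1 else 0)"

definition ind :: "nat \<Rightarrow> complex \<Rightarrow> tdiagram \<Rightarrow> int" where
  "ind l c K =
     (\<Sum>t | t \<in> component_params K c l \<and> strand K t \<in> classical_crossings K.
        (- 1) ^ eps K t * csign K (strand K t))"

definition zero_crossings :: "tdiagram \<Rightarrow> complex set" where
  "zero_crossings K = {c \<in> classical_crossings K. \<exists>l \<in> {0, 1}. even (ind l c K)}"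

definition zind :: "nat \<Rightarrow> complex \<Rightarrow> tdiagram \<Rightarrow> int" where
  "zind l c K =
     (\<Sum>t | t \<in> component_params K c l \<and> strand K t \<in> zero_crossings K.
        (- 1) ^ eps K t * csign K (strand K t))"


section \<open>Planar isotopy and change of parameter\<close>

definition plane_isotopy :: "(real \<Rightarrow> complex \<Rightarrow> complex) \<Rightarrow> bool" where
  "plane_isotopy H \<longleftrightarrow>
     (\<forall>z. H 0 z = z) \<and>
     continuous_on ({0..1} \<times> UNIV) (\<lambda>(s, z). H s z) \<and>
     (\<exists>H' :: real \<Rightarrow> complex \<Rightarrow> complex \<Rightarrow>\<^sub>L complex.
        continuous_on ({0..1} \<times> UNIV) (\<lambda>(s, z). H' s z) \<and>
        (\<forall>s \<in> {0..1}. bij (H s) \<and>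
           (\<forall>z. (H s has_derivative blinfun_apply (H' s z)) (at z) \<and> inj (blinfun_apply (H' s z)))))"

definition planar_isotopic :: "tdiagram \<Rightarrow> tdiagram \<Rightarrow> bool" where
  "planar_isotopic K K' \<longleftrightarrow>
     (\<exists>H. plane_isotopy H \<and> strand K' = H 1 \<circ> strand K \<and> over K' = over K \<and> bars K' = bars K)"

definition reparametrized :: "tdiagram \<Rightarrow> tdiagram \<Rightarrow> bool" where
  "reparametrized K K' \<longleftrightarrow>
     (\<exists>h :: real \<Rightarrow> real. h C1_differentiable_on UNIV \<and> (\<forall>t. 0 < vector_derivative h (at t)) \<and>
        (\<forall>t. h (t + 1) = h t + 1) \<and>
        strand K' = strand K \<circ> h \<and> over K' = h -` over K \<and> bars K' = h -` bars K)"


section \<open>Reidemeister moves\<close>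

text \<open>A move replaces the part of a diagram in a disc \<open>D\<close>, which consists of finitely many proper
  arcs with distinct end points, by another such tangle with the same end points and the same
  connectivity. Each arc is given by the end points of its parameter interval, which is the same
  before and after the move. That no arc contains the parameter 0 can be achieved by a change of
  parameter.\<close>

definition open_arc :: "real \<times> real \<Rightarrow> real set" where
  "open_arc I = {fst I <..< snd I}"

definition arc_params :: "(real \<times> real) list \<Rightarrow> real set" where
  "arc_params Is = (\<Union>I \<in> set Is. open_arc I)"

definition arc_ends :: "(real \<times> real) list \<Rightarrow> real set" where
  "arc_ends Is = (\<Union>I \<in> set Is. {fst I, snd I})"

definition meets_disc_in :: "tdiagram \<Rightarrow> complex set \<Rightarrow> (real \<times> real) list \<Rightarrow> bool" where
  "meets_disc_in K D Is \<longleftrightarrow>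
     (\<forall>t \<in> {0..<1}. (strand K t \<in> interior D \<longleftrightarrow> t \<in> arc_params Is) \<and>
                    (strand K t \<in> frontier D \<longleftrightarrow> t \<in> arc_ends Is)) \<and>
     inj_on (strand K) (arc_ends Is)"

definition local_change :: "tdiagram \<Rightarrow> tdiagram \<Rightarrow> (real \<times> real) list \<Rightarrow> bool" where
  "local_change K K' Is \<longleftrightarrow>
     (\<forall>I \<in> set Is. 0 < fst I \<and> fst I < snd I \<and> snd I < 1) \<and>
     distinct Is \<and>
     pairwise (\<lambda>I J. disjnt {fst I..snd I} {fst J..snd J}) (set Is) \<and>
     (\<exists>D. D homeomorphic cball (0 :: complex) 1 \<and> meets_disc_in K D Is \<and> meets_disc_in K' D Is) \<and>
     (\<forall>t \<in> {0..<1} - arc_params Is.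
        strand K' t = strand K t \<and> (t \<in> over K' \<longleftrightarrow> t \<in> over K) \<and> (t \<in> bars K' \<longleftrightarrow> t \<in> bars K))"

text \<open>\<open>tangle K Is C V B\<close>: on the arcs \<open>Is\<close>, the classical crossings of \<open>K\<close> are those listed in \<open>C\<close>
  as pairs (over parameter, under parameter), the virtual crossings are those listed in \<open>V\<close> as pairs
  of parameters in either order, and the bars are those in \<open>B\<close>.\<close>

definition tangle ::
  "tdiagram \<Rightarrow> (real \<times> real) list \<Rightarrow> (real \<times> real) set \<Rightarrow> (real \<times> real) set \<Rightarrow> real set \<Rightarrow> bool" where
  "tangle K Is C V B \<longleftrightarrow>
     {(s, t). s \<in> arc_params Is \<and> t \<in> arc_params Is \<and> s \<noteq> t \<and> strand K s = strand K t \<and>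
              s \<in> over K \<and> t \<notin> over K} = C \<and>
     {(s, t). s \<in> arc_params Is \<and> t \<in> arc_params Is \<and> s \<noteq> t \<and> strand K s = strand K t \<and>
              s \<notin> over K \<and> t \<notin> over K} = V \<union> V\<inverse> \<and>
     bars K \<inter> arc_params Is = B"

text \<open>In a disc, each tangle below is determined up to isotopy by its end points, the order of its
  crossings along the arcs, the over/under information and the bars. The conditions on signs in
  \<open>move_C2\<close>, \<open>move_C3\<close>, \<open>move_V4\<close> and \<open>move_T3\<close> restrict nothing further: they follow from the
  intersection numbers of the arcs, which depend only on the positions of the end points.\<close>

definition move_C1 :: "tdiagram \<Rightarrow> tdiagram \<Rightarrow> bool" where
  "move_C1 K K' \<longleftrightarrow> (\<exists>I s t. local_change K K' [I] \<and>
     tangle K [I] {} {} {} \<and> tangle K' [I] {(s, t)} {} {})"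

definition move_V1 :: "tdiagram \<Rightarrow> tdiagram \<Rightarrow> bool" where
  "move_V1 K K' \<longleftrightarrow> (\<exists>I s t. local_change K K' [I] \<and>
     tangle K [I] {} {} {} \<and> tangle K' [I] {} {(s, t)} {})"

definition move_C2 :: "tdiagram \<Rightarrow> tdiagram \<Rightarrow> bool" where
  "move_C2 K K' \<longleftrightarrow> (\<exists>I J s1 s2 t1 t2. local_change K K' [I, J] \<and>
     {s1, s2} \<subseteq> open_arc I \<and> {t1, t2} \<subseteq> open_arc J \<and> s1 \<noteq> s2 \<and>
     tangle K [I, J] {} {} {} \<and> tangle K' [I, J] {(s1, t1), (s2, t2)} {} {} \<and>
     csign K' (strand K' s1) = - csign K' (strand K' s2))"

definition move_V2 :: "tdiagram \<Rightarrow> tdiagram \<Rightarrow> bool" where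
  "move_V2 K K' \<longleftrightarrow> (\<exists>I J s1 s2 t1 t2. local_change K K' [I, J] \<and>
     {s1, s2} \<subseteq> open_arc I \<and> {t1, t2} \<subseteq> open_arc J \<and> s1 \<noteq> s2 \<and>
     tangle K [I, J] {} {} {} \<and> tangle K' [I, J] {} {(s1, t1), (s2, t2)} {})"

text \<open>The third moves: three arcs \<open>I\<close>, \<open>J\<close>, \<open>L\<close> of which any two cross exactly once. The arc \<open>I\<close> meets
  \<open>J\<close> at \<open>i1\<close> and \<open>L\<close> at \<open>i2\<close>, the arc \<open>J\<close> meets \<open>I\<close> at \<open>j1\<close> and \<open>L\<close> at \<open>j2\<close>, the arc \<open>L\<close> meets
  \<open>I\<close> at \<open>l1\<close> and \<open>J\<close> at \<open>l2\<close>; primed parameters belong to the diagram after the move. Moving one arc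
  across the crossing of the other two reverses the order of the two crossings on each arc.\<close>

definition triangle_change ::
  "tdiagram \<Rightarrow> tdiagram \<Rightarrow> real \<times> real \<Rightarrow> real \<times> real \<Rightarrow> real \<times> real \<Rightarrow>
   real \<Rightarrow> real \<Rightarrow> real \<Rightarrow> real \<Rightarrow> real \<Rightarrow> real \<Rightarrow> real \<Rightarrow> real \<Rightarrow> real \<Rightarrow> real \<Rightarrow> real \<Rightarrow> real \<Rightarrow> bool" where
  "triangle_change K K' I J L i1 i2 j1 j2 l1 l2 i1' i2' j1' j2' l1' l2' \<longleftrightarrow>
     local_change K K' [I, J, L] \<and>
     {i1, i2, i1', i2'} \<subseteq> open_arc I \<and> {j1, j2, j1', j2'} \<subseteq> open_arc J \<and>
     {l1, l2, l1', l2'} \<subseteq> open_arc L \<and>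
     (i1 < i2 \<longleftrightarrow> i2' < i1') \<and> (j1 < j2 \<longleftrightarrow> j2' < j1') \<and> (l1 < l2 \<longleftrightarrow> l2' < l1')"

definition move_C3 :: "tdiagram \<Rightarrow> tdiagram \<Rightarrow> bool" where
  "move_C3 K K' \<longleftrightarrow> (\<exists>I J L i1 i2 j1 j2 l1 l2 i1' i2' j1' j2' l1' l2'.
     triangle_change K K' I J L i1 i2 j1 j2 l1 l2 i1' i2' j1' j2' l1' l2' \<and>
     tangle K [I, J, L] {(i1, j1), (i2, l1), (j2, l2)} {} {} \<and>
     tangle K' [I, J, L] {(i1', j1'), (i2', l1'), (j2', l2')} {} {} \<and>
     csign K' (strand K' i1') = csign K (strand K i1) \<and>
     csign K' (strand K' i2') = csign K (strand K i2) \<and>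
     csign K' (strand K' j2') = csign K (strand K j2))"

definition move_V3 :: "tdiagram \<Rightarrow> tdiagram \<Rightarrow> bool" where
  "move_V3 K K' \<longleftrightarrow> (\<exists>I J L i1 i2 j1 j2 l1 l2 i1' i2' j1' j2' l1' l2'.
     triangle_change K K' I J L i1 i2 j1 j2 l1 l2 i1' i2' j1' j2' l1' l2' \<and>
     tangle K [I, J, L] {} {(i1, j1), (i2, l1), (j2, l2)} {} \<and>
     tangle K' [I, J, L] {} {(i1', j1'), (i2', l1'), (j2', l2')} {})"

definition move_V4 :: "tdiagram \<Rightarrow> tdiagram \<Rightarrow> bool" where
  "move_V4 K K' \<longleftrightarrow> (\<exists>I J L i1 i2 j1 j2 l1 l2 i1' i2' j1' j2' l1' l2'.
     triangle_change K K' I J L i1 i2 j1 j2 l1 l2 i1' i2' j1' j2' l1' l2' \<and>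
     tangle K [I, J, L] {(j2, l2)} {(i1, j1), (i2, l1)} {} \<and>
     tangle K' [I, J, L] {(j2', l2')} {(i1', j1'), (i2', l1')} {} \<and>
     csign K' (strand K' j2') = csign K (strand K j2))"

definition move_T1 :: "tdiagram \<Rightarrow> tdiagram \<Rightarrow> bool" where
  "move_T1 K K' \<longleftrightarrow> (\<exists>I s t. local_change K K' [I] \<and> s \<noteq> t \<and>
     tangle K [I] {} {} {} \<and> tangle K' [I] {} {} {s, t})"

definition move_T2 :: "tdiagram \<Rightarrow> tdiagram \<Rightarrow> bool" where
  "move_T2 K K' \<longleftrightarrow> (\<exists>I J s t s' t' u u'. local_change K K' [I, J] \<and>
     {s, s', u, u'} \<subseteq> open_arc I \<and> {t, t'} \<subseteq> open_arc J \<and> u < s \<and> s' < u' \<and>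
     tangle K [I, J] {} {(s, t)} {u} \<and> tangle K' [I, J] {} {(s', t')} {u'})"

text \<open>The arc \<open>J\<close> may meet the three crossings of the new tangle in the same order as \<open>I\<close> or in the
  opposite one; the two possibilities account for the different orientations of the strands.\<close>

definition move_T3 :: "tdiagram \<Rightarrow> tdiagram \<Rightarrow> bool" where
  "move_T3 K K' \<longleftrightarrow> (\<exists>I J s t s1 s2 t1 t2 s' t' v1 v2 w1 w2. local_change K K' [I, J] \<and>
     {s, s1, s2, s', v1, v2} \<subseteq> open_arc I \<and> {t, t1, t2, t', w1, w2} \<subseteq> open_arc J \<and>
     s1 < s \<and> s < s2 \<and> t1 < t \<and> t < t2 \<and> tangle K [I, J] {(s, t)} {} {s1, s2, t1, t2} \<and>
     v1 < s' \<and> s' < v2 \<and> (w1 < t' \<and> t' < w2 \<or> w2 < t' \<and> t' < w1) \<and>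
     tangle K' [I, J] {(t', s')} {(v1, w1), (v2, w2)} {} \<and>
     csign K' (strand K' s') = csign K (strand K s))"


section \<open>Knot types and cosmetic crossing changes\<close>

definition elementary_step :: "tdiagram \<Rightarrow> tdiagram \<Rightarrow> bool" where
  "elementary_step K K' \<longleftrightarrow> twisted_diagram K \<and> twisted_diagram K' \<and>
     (planar_isotopic K K' \<or> reparametrized K K' \<or>
      move_C1 K K' \<or> move_C2 K K' \<or> move_C3 K K' \<or>
      move_V1 K K' \<or> move_V2 K K' \<or> move_V3 K K' \<or> move_V4 K K' \<or>
      move_T1 K K' \<or> move_T2 K K' \<or> move_T3 K K')"

definition knot_type :: "tdiagram \<Rightarrow> tdiagram set" where
  "knot_type K = {K'. equivclp elementary_step K K'}"

definition crossing_change :: "tdiagram \<Rightarrow> complex \<Rightarrow> tdiagram" where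
  "crossing_change K c =
     K\<lparr>over := {t. if strand K t = c then t \<notin> over K else t \<in> over K}\<rparr>"

text \<open>The witnessing circle is a smoothly embedded closed curve.\<close>

definition nugatory :: "tdiagram \<Rightarrow> complex \<Rightarrow> bool" where
  "nugatory K c \<longleftrightarrow>
     (\<exists>g. closed_immersion g \<and> inj_on g {0..<1} \<and> range g \<inter> range (strand K) = {c} \<and>
        (\<forall>u t. g u = c \<and> strand K t = c \<longrightarrow>
           det2 (vector_derivative g (at u)) (vector_derivative (strand K) (at t)) \<noteq> 0))"

definition cosmetic_crossing :: "tdiagram \<Rightarrow> complex \<Rightarrow> bool" where
  "cosmetic_crossing K c \<longleftrightarrow>
     c \<in> classical_crossings K \<and> \<not> nugatory K c \<and> knot_type (crossing_change K c) = knot_type K"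

definition admits_cosmetic_crossing_change :: "tdiagram \<Rightarrow> bool" where
  "admits_cosmetic_crossing_change K \<longleftrightarrow> (\<exists>c. cosmetic_crossing K c)"

end

theory Submission
  imports Defs
begin

text \<open>Call two classical crossings interlaced if the passages through one separate the passages through
  the other along the curve. The parity of the index of a crossing is the parity of its degree in the
  graph of interlaced crossings, and that of its zero affine index is the parity of its degree in the
  subgraph of the vertices of even degree. The sum of the signs of the crossings of odd degree, taken
  in the graph and again in this subgraph, is invariant under all moves: \<open>C1\<close> adds an isolated vertex,
  \<open>C2\<close> adds two vertices of opposite sign with the same neighbours, \<open>C3\<close> complements the three edges
  among vertices of which every further vertex sees an even number, and the other moves, including
  \<open>T3\<close>, change nothing. A crossing change preserves the graph and negates one sign; under the
  hypotheses this changes one of the two sums.\<close>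

section \<open>Writhes of signed graphs\<close>

text \<open>The terms of an index are signs, so modulo 2 it counts passages, and a component of the
  smoothing at \<open>c\<close> passes another crossing once if the two are interlaced and zero or
  two times otherwise. Working modulo 2 is forced by \<open>T3\<close>: it exchanges over and under
  at a crossing and keeps the sign, which negates the term of that crossing in the indices of the
  others. The signs themselves are summed over the integers, because negating one of them changes
  such a sum by twice that sign. The delicate point is the second sum under \<open>C3\<close>.
  Complementing all three edges of a triangle keeps every degree parity, but if exactly two of its
  vertices lay in the even subgraph, a single edge would be complemented there and both of its ends
  would change parity. The condition on the further vertices excludes this case. Interlacement is
  read off from parameters in \<open>{0..<1}\<close>, that is, after cutting the circle at 0. No arc
  of a local move contains 0, so the choice of the cut matters only for
  \<open>reparametrized\<close>.\<close>

definition odd_degree :: "('a \<Rightarrow> 'a \<Rightarrow> bool) \<Rightarrow> 'a set \<Rightarrow> 'a \<Rightarrow> bool" where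
  "odd_degree L S c \<longleftrightarrow> odd (\<Sum>d \<in> S - {c}. of_bool (L c d) :: nat)"

definition even_part :: "('a \<Rightarrow> 'a \<Rightarrow> bool) \<Rightarrow> 'a set \<Rightarrow> 'a set" where
  "even_part L G = {c \<in> G. \<not> odd_degree L G c}"

text \<open>For the interlacement graph of a diagram this is the odd writhe known from virtual knot
  theory.\<close>

definition odd_writhe :: "('a \<Rightarrow> 'a \<Rightarrow> bool) \<Rightarrow> ('a \<Rightarrow> int) \<Rightarrow> 'a set \<Rightarrow> int" where
  "odd_writhe L \<sigma> G = (\<Sum>c | c \<in> G \<and> odd_degree L G c. \<sigma> c)"

definition same_writhes ::
  "('a \<Rightarrow> 'a \<Rightarrow> bool) \<Rightarrow> ('a \<Rightarrow> int) \<Rightarrow> 'a set \<Rightarrow> ('b \<Rightarrow> 'b \<Rightarrow> bool) \<Rightarrow> ('b \<Rightarrow> int) \<Rightarrow> 'b set \<Rightarrow> bool" where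
  "same_writhes L \<sigma> G L' \<sigma>' G' \<longleftrightarrow>
     odd_writhe L \<sigma> G = odd_writhe L' \<sigma>' G' \<and>
     odd_writhe L \<sigma> (even_part L G) = odd_writhe L' \<sigma>' (even_part L' G')"

lemma odd_sum_cong:
  fixes f g :: "'a \<Rightarrow> nat"
  assumes "finite A" "\<And>x. x \<in> A \<Longrightarrow> odd (f x) \<longleftrightarrow> odd (g x)"
  shows "odd (sum f A) \<longleftrightarrow> odd (sum g A)"
  using assms by (induction A rule: finite_induct) auto

lemma odd_sum_xor:
  fixes f g h :: "'a \<Rightarrow> nat"
  assumes "finite A" "\<And>x. x \<in> A \<Longrightarrow> odd (f x) \<longleftrightarrow> (odd (g x) \<noteq> odd (h x))"
  shows "odd (sum f A) \<longleftrightarrow> (odd (sum g A) \<noteq> odd (sum h A))"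
proof -
  have "odd (sum f A) \<longleftrightarrow> odd (\<Sum>x\<in>A. g x + h x)"
    by (rule odd_sum_cong) (use assms in auto)
  then show ?thesis by (simp add: sum.distrib)
qed

lemma finite_even_part [simp]: "finite G \<Longrightarrow> finite (even_part L G)"
  by (simp add: even_part_def)

lemma odd_writhe_reindex:
  assumes f: "bij_betw f G G'"
    and deg: "\<And>x. x \<in> G \<Longrightarrow> odd_degree L' G' (f x) \<longleftrightarrow> odd_degree L G x"
    and sgn: "\<And>x. x \<in> G \<Longrightarrow> \<sigma>' (f x) = \<sigma> x"
  shows "odd_writhe L \<sigma> G = odd_writhe L' \<sigma>' G'"
proof -
  have "bij_betw f {c \<in> G. odd_degree L G c} {c \<in> G'. odd_degree L' G' c}"
    using f deg by (auto simp: bij_betw_def inj_on_def)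
  from sum.reindex_bij_betw[OF this, of \<sigma>'] show ?thesis
    unfolding odd_writhe_def using sgn by (metis (mono_tags, lifting) mem_Collect_eq sum.cong)
qed

lemma even_part_reindex:
  assumes f: "bij_betw f G G'"
    and deg: "\<And>x. x \<in> G \<Longrightarrow> odd_degree L' G' (f x) \<longleftrightarrow> odd_degree L G x"
  shows "bij_betw f (even_part L G) (even_part L' G')"
  using assms by (auto simp: even_part_def bij_betw_def inj_on_def)

text \<open>Complementing the edges inside a set of odd size changes every degree by an even number.\<close>

lemma odd_degree_flip:
  assumes "finite G" and f: "bij_betw f G G'"
    and T: "T \<subseteq> G" "T = {} \<or> odd (card T)"
    and L: "\<And>x y. x \<in> G \<Longrightarrow> y \<in> G \<Longrightarrow> x \<noteq> y \<Longrightarrow>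
              L' (f x) (f y) \<longleftrightarrow> (L x y \<noteq> (x \<in> T \<and> y \<in> T))"
    and x: "x \<in> G"
  shows "odd_degree L' G' (f x) \<longleftrightarrow> odd_degree L G x"
proof -
  have "finite T" using T \<open>finite G\<close> finite_subset by auto
  have b: "bij_betw f (G - {x}) (G' - {f x})"
    using f x by (auto simp: bij_betw_def inj_on_def)
  have "odd_degree L' G' (f x) \<longleftrightarrow> odd (\<Sum>y \<in> G - {x}. of_bool (L' (f x) (f y)) :: nat)"
    unfolding odd_degree_def sum.reindex_bij_betw[OF b, symmetric] ..
  moreover have "odd (\<Sum>y \<in> G - {x}. of_bool (L' (f x) (f y)) :: nat) \<longleftrightarrow>
    (odd (\<Sum>y \<in> G - {x}. of_bool (L x y) :: nat) \<noteq>
     odd (\<Sum>y \<in> G - {x}. of_bool (x \<in> T \<and> y \<in> T) :: nat))"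
    by (rule odd_sum_xor) (use \<open>finite G\<close> L x in auto)
  moreover have "even (\<Sum>y \<in> G - {x}. of_bool (x \<in> T \<and> y \<in> T) :: nat)"
  proof (cases "x \<in> T")
    case True
    have "(\<Sum>y \<in> G - {x}. of_bool (x \<in> T \<and> y \<in> T) :: nat) = (\<Sum>y \<in> T - {x}. 1)"
      using True T \<open>finite G\<close> by (intro sum.mono_neutral_cong_right) auto
    also have "\<dots> = card T - 1" using True \<open>finite T\<close> by simp
    finally show ?thesis using T True by auto
  qed auto
  ultimately show ?thesis by (simp add: odd_degree_def)
qed

lemma odd_degree_triple:
  assumes "finite G" "x \<in> G" "y \<in> G" "z \<in> G" "x \<noteq> y" "x \<noteq> z" "y \<noteq> z"
  shows "odd_degree L G x \<longleftrightarrow>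
    ((odd (\<Sum>d \<in> G - {x, y, z}. of_bool (L x d) :: nat) \<noteq> L x y) \<noteq> L x z)"
proof -
  have "G - {x} = insert y (insert z (G - {x, y, z}))" using assms by auto
  then show ?thesis unfolding odd_degree_def using assms
    by (simp del: sum_of_bool_eq)
qed

text \<open>Modulo 2 the degrees of \<open>a\<close>, \<open>b\<close>, \<open>c\<close> add up to
  zero: each of the three edges is counted at both ends, and the contributions of the further
  vertices cancel by the last assumption. So an even number of the three degrees is odd, and one or
  three of the vertices lie in the even part.\<close>

lemma even_part_triple:
  assumes G: "finite G" "a \<in> G" "b \<in> G" "c \<in> G" "a \<noteq> b" "a \<noteq> c" "b \<noteq> c"
    and sym: "L a b \<longleftrightarrow> L b a" "L a c \<longleftrightarrow> L c a" "L b c \<longleftrightarrow> L c b"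
    and ev: "\<And>d. d \<in> G - {a, b, c} \<Longrightarrow> L a d \<longleftrightarrow> (L b d \<noteq> L c d)"
  shows "odd (card ({a, b, c} \<inter> even_part L G))"
proof -
  let ?s = "\<lambda>x. (\<Sum>d \<in> G - {a, b, c}. of_bool (L x d) :: nat)"
  have eq: "{b, a, c} = {a, b, c}" "{c, a, b} = {a, b, c}" by auto
  have "odd (?s a) \<longleftrightarrow> (odd (?s b) \<noteq> odd (?s c))"
    by (rule odd_sum_xor) (use G ev in auto)
  moreover have "odd_degree L G a \<longleftrightarrow> ((odd (?s a) \<noteq> L a b) \<noteq> L a c)"
    using G by (intro odd_degree_triple) auto
  moreover have "odd_degree L G b \<longleftrightarrow> ((odd (?s b) \<noteq> L b a) \<noteq> L b c)"
    using odd_degree_triple[of G b a c L, unfolded eq] G by blast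
  moreover have "odd_degree L G c \<longleftrightarrow> ((odd (?s c) \<noteq> L c a) \<noteq> L c b)"
    using odd_degree_triple[of G c a b L, unfolded eq] G by blast
  ultimately have "odd_degree L G a \<longleftrightarrow> (odd_degree L G b \<noteq> odd_degree L G c)"
    using sym by argo
  moreover have "card ({a, b, c} \<inter> even_part L G) =
    of_bool (\<not> odd_degree L G a) + of_bool (\<not> odd_degree L G b) + of_bool (\<not> odd_degree L G c)"
    using G by (auto simp: even_part_def Int_insert_left)
  ultimately show ?thesis by auto
qed

text \<open>The complementation acts twice, on \<open>G\<close> through \<open>T\<close> and on the
  even part through \<open>T \<inter> even_part L G\<close>; as degree parities survive the first
  step, \<open>f\<close> also maps one even part onto the other. Unless \<open>T\<close> is empty,
  both sets need odd size for \<open>odd_degree_flip\<close> to apply.\<close>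

lemma same_writhes_flip:
  assumes "finite G" and f: "bij_betw f G G'"
    and T: "T \<subseteq> G" "T = {} \<or> odd (card T) \<and> odd (card (T \<inter> even_part L G))"
    and L: "\<And>x y. x \<in> G \<Longrightarrow> y \<in> G \<Longrightarrow> x \<noteq> y \<Longrightarrow>
              L' (f x) (f y) \<longleftrightarrow> (L x y \<noteq> (x \<in> T \<and> y \<in> T))"
    and sgn: "\<And>x. x \<in> G \<Longrightarrow> \<sigma>' (f x) = \<sigma> x"
  shows "same_writhes L \<sigma> G L' \<sigma>' G'"
proof -
  have deg: "odd_degree L' G' (f x) \<longleftrightarrow> odd_degree L G x" if "x \<in> G" for x
    by (rule odd_degree_flip[where T = T]) (use assms that in auto)
  have f2: "bij_betw f (even_part L G) (even_part L' G')"
    by (rule even_part_reindex) (use f deg in auto)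
  have sub: "even_part L G \<subseteq> G" by (auto simp: even_part_def)
  have deg2: "odd_degree L' (even_part L' G') (f x) \<longleftrightarrow> odd_degree L (even_part L G) x"
    if "x \<in> even_part L G" for x
  proof (rule odd_degree_flip[OF _ f2, where T = "T \<inter> even_part L G"])
    show "T \<inter> even_part L G = {} \<or> odd (card (T \<inter> even_part L G))" using T by auto
    show "L' (f x) (f y) \<longleftrightarrow> (L x y \<noteq> (x \<in> T \<inter> even_part L G \<and> y \<in> T \<inter> even_part L G))"
      if "x \<in> even_part L G" "y \<in> even_part L G" "x \<noteq> y" for x y
      using L[of x y] that sub by auto
  qed (use that \<open>finite G\<close> in auto)
  have "odd_writhe L \<sigma> G = odd_writhe L' \<sigma>' G'"
    by (rule odd_writhe_reindex[where f = f]) (use f deg sgn in auto)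
  moreover have "odd_writhe L \<sigma> (even_part L G) = odd_writhe L' \<sigma>' (even_part L' G')"
    by (rule odd_writhe_reindex[where f = f]) (use f2 deg2 sgn sub in auto)
  ultimately show ?thesis unfolding same_writhes_def ..
qed

lemma same_writhes_iso:
  assumes "finite G" "bij_betw f G G'"
    and "\<And>x y. x \<in> G \<Longrightarrow> y \<in> G \<Longrightarrow> x \<noteq> y \<Longrightarrow> L' (f x) (f y) \<longleftrightarrow> L x y"
    and "\<And>x. x \<in> G \<Longrightarrow> \<sigma>' (f x) = \<sigma> x"
  shows "same_writhes L \<sigma> G L' \<sigma>' G'"
  by (rule same_writhes_flip[where f = f and T = "{}"]) (use assms in auto)

lemma same_writhes_sym: "same_writhes L \<sigma> G L' \<sigma>' G' \<Longrightarrow> same_writhes L' \<sigma>' G' L \<sigma> G"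
  by (simp add: same_writhes_def)

lemma same_writhes_trans:
  "same_writhes L \<sigma> G L' \<sigma>' G' \<Longrightarrow> same_writhes L' \<sigma>' G' L'' \<sigma>'' G'' \<Longrightarrow>
   same_writhes L \<sigma> G L'' \<sigma>'' G''"
  by (simp add: same_writhes_def)

section \<open>Graph operations realised by the moves\<close>

lemma odd_degree_isolated:
  assumes "finite G" "a \<notin> G" "\<And>d. d \<in> G \<Longrightarrow> \<not> L a d \<and> \<not> L d a"
  shows "\<not> odd_degree L (insert a G) a"
    and "x \<in> G \<Longrightarrow> odd_degree L (insert a G) x \<longleftrightarrow> odd_degree L G x"
proof -
  show "\<not> odd_degree L (insert a G) a"
    using assms by (simp add: odd_degree_def)
  assume "x \<in> G"
  then have "insert a G - {x} = insert a (G - {x})" using assms by auto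
  then show "odd_degree L (insert a G) x \<longleftrightarrow> odd_degree L G x"
    using assms \<open>x \<in> G\<close> by (simp add: odd_degree_def del: sum_of_bool_eq)
qed

text \<open>An isolated vertex has degree zero, so it is not counted in the first sum; it enters the
  even part and is isolated there again.\<close>

lemma same_writhes_isolated:
  assumes "finite G" "a \<notin> G" "\<And>d. d \<in> G \<Longrightarrow> \<not> L a d \<and> \<not> L d a"
  shows "same_writhes L \<sigma> G L \<sigma> (insert a G)"
proof -
  have W: "odd_writhe L \<sigma> (insert a S) = odd_writhe L \<sigma> S" if "S \<subseteq> G" for S
  proof -
    have "{c \<in> insert a S. odd_degree L (insert a S) c} = {c \<in> S. odd_degree L S c}"
      using odd_degree_isolated[of S a L] that assms by (auto dest: finite_subset)
    then show ?thesis by (simp add: odd_writhe_def)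
  qed
  have "even_part L (insert a G) = insert a (even_part L G)"
    using odd_degree_isolated[of G a L] assms by (auto simp: even_part_def)
  then show ?thesis
    using W[of G] W[of "even_part L G"] by (auto simp: same_writhes_def even_part_def)
qed

text \<open>An edge between the twins counts once at either end, and their other neighbours agree.
  Any further vertex sees both twins or neither.\<close>

lemma odd_degree_twins:
  assumes "finite G" "a \<notin> G" "b \<notin> G" "a \<noteq> b" "L a b \<longleftrightarrow> L b a"
    and "\<And>d. d \<in> G \<Longrightarrow> (L a d \<longleftrightarrow> L b d) \<and> (L d a \<longleftrightarrow> L d b)"
  shows "odd_degree L (insert a (insert b G)) a \<longleftrightarrow> odd_degree L (insert a (insert b G)) b"
    and "x \<in> G \<Longrightarrow> odd_degree L (insert a (insert b G)) x \<longleftrightarrow> odd_degree L G x"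
proof -
  have "insert a (insert b G) - {a} = insert b G" "insert a (insert b G) - {b} = insert a G"
    using assms by auto
  moreover have "(\<Sum>d\<in>G. of_bool (L a d) :: nat) = (\<Sum>d\<in>G. of_bool (L b d))"
    by (rule sum.cong) (use assms in auto)
  ultimately show "odd_degree L (insert a (insert b G)) a \<longleftrightarrow> odd_degree L (insert a (insert b G)) b"
    using assms by (simp add: odd_degree_def del: sum_of_bool_eq)
  assume "x \<in> G"
  then have "insert a (insert b G) - {x} = insert a (insert b (G - {x}))" using assms by auto
  then show "odd_degree L (insert a (insert b G)) x \<longleftrightarrow> odd_degree L G x"
    using assms \<open>x \<in> G\<close> by (simp add: odd_degree_def del: sum_of_bool_eq)
qed

text \<open>Twins of odd degree cancel by their opposite signs, twins of even degree are not
  counted. The even part gains both or neither, so the same argument applies to it; hence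
  \<open>W\<close> is proved for all subsets of \<open>G\<close>.\<close>

lemma same_writhes_twins:
  assumes "finite G" "a \<notin> G" "b \<notin> G" "a \<noteq> b" "L a b \<longleftrightarrow> L b a"
    and "\<And>d. d \<in> G \<Longrightarrow> (L a d \<longleftrightarrow> L b d) \<and> (L d a \<longleftrightarrow> L d b)"
    and \<sigma>: "\<sigma> a = - \<sigma> b"
  shows "same_writhes L \<sigma> G L \<sigma> (insert a (insert b G))"
proof -
  let ?ab = "\<lambda>S. insert a (insert b S)"
  have W: "odd_writhe L \<sigma> (?ab S) = odd_writhe L \<sigma> S" if "S \<subseteq> G" for S
  proof -
    have S: "finite S" "a \<notin> S" "b \<notin> S" using that assms finite_subset by auto
    have d: "odd_degree L (?ab S) a \<longleftrightarrow> odd_degree L (?ab S) b"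
      "\<And>x. x \<in> S \<Longrightarrow> odd_degree L (?ab S) x \<longleftrightarrow> odd_degree L S x"
      using odd_degree_twins[of S a b L] that assms S by blast+
    have "{c \<in> ?ab S. odd_degree L (?ab S) c} =
      {c \<in> S. odd_degree L S c} \<union> (if odd_degree L (?ab S) b then {a, b} else {})"
      using d by auto
    then show ?thesis using S assms(4) \<sigma> by (simp add: odd_writhe_def)
  qed
  have d: "odd_degree L (?ab G) a \<longleftrightarrow> odd_degree L (?ab G) b"
    "\<And>x. x \<in> G \<Longrightarrow> odd_degree L (?ab G) x \<longleftrightarrow> odd_degree L G x"
    using odd_degree_twins[of G a b L] assms by blast+
  have "even_part L (?ab G) = even_part L G \<or> even_part L (?ab G) = ?ab (even_part L G)"
    using d by (auto simp: even_part_def)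
  moreover have "even_part L G \<subseteq> G" by (auto simp: even_part_def)
  ultimately show ?thesis using W by (auto simp: same_writhes_def)
qed

text \<open>The new crossings may be other points of the plane, and a primed vertex may coincide
  with an unprimed one in another role. Hence the explicit renaming \<open>f\<close>, which fixes
  \<open>G\<close> and reduces the claim to a complementation inside
  \<open>{a, b, c}\<close>.\<close>

lemma same_writhes_triangle:
  assumes fin: "finite G"
    and abc: "a \<notin> G" "b \<notin> G" "c \<notin> G" "a \<noteq> b" "a \<noteq> c" "b \<noteq> c"
    and abc': "a' \<notin> G" "b' \<notin> G" "c' \<notin> G" "a' \<noteq> b'" "a' \<noteq> c'" "b' \<noteq> c'"
    and sym: "\<And>x y. x \<in> insert a (insert b (insert c G)) \<Longrightarrow> y \<in> insert a (insert b (insert c G)) \<Longrightarrow>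
                x \<noteq> y \<Longrightarrow> L x y \<longleftrightarrow> L y x"
    and sym': "\<And>x y. x \<in> insert a' (insert b' (insert c' G)) \<Longrightarrow> y \<in> insert a' (insert b' (insert c' G)) \<Longrightarrow>
                x \<noteq> y \<Longrightarrow> L' x y \<longleftrightarrow> L' y x"
    and toggle: "L' a' b' \<longleftrightarrow> \<not> L a b" "L' a' c' \<longleftrightarrow> \<not> L a c" "L' b' c' \<longleftrightarrow> \<not> L b c"
    and out: "\<And>d. d \<in> G \<Longrightarrow> L' a' d \<longleftrightarrow> L a d" "\<And>d. d \<in> G \<Longrightarrow> L' b' d \<longleftrightarrow> L b d"
      "\<And>d. d \<in> G \<Longrightarrow> L' c' d \<longleftrightarrow> L c d" "\<And>d. d \<in> G \<Longrightarrow> L a d \<longleftrightarrow> (L b d \<noteq> L c d)"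
      "\<And>d e. d \<in> G \<Longrightarrow> e \<in> G \<Longrightarrow> L' d e \<longleftrightarrow> L d e"
    and \<sigma>: "\<sigma>' a' = \<sigma> a" "\<sigma>' b' = \<sigma> b" "\<sigma>' c' = \<sigma> c" "\<And>d. d \<in> G \<Longrightarrow> \<sigma>' d = \<sigma> d"
  shows "same_writhes L \<sigma> (insert a (insert b (insert c G))) L' \<sigma>' (insert a' (insert b' (insert c' G)))"
    (is "same_writhes L \<sigma> ?G L' \<sigma>' ?G'")
proof -
  define f where "f = id(a := a', b := b', c := c')"
  have f: "f a = a'" "f b = b'" "f c = c'" and fG: "\<And>d. d \<in> G \<Longrightarrow> f d = d"
    using abc by (auto simp: f_def)
  let ?T = "{a, b, c}"
  show ?thesis
  proof (rule same_writhes_flip)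
    show "finite ?G" using fin by simp
    have "f ` G = G" using fG by simp
    then show bij: "bij_betw f ?G ?G'"
      using abc abc' by (auto simp: bij_betw_def inj_on_def f fG)
    show "?T \<subseteq> ?G" by auto
    have "odd (card (?T \<inter> even_part L ?G))"
    proof (rule even_part_triple)
      show "L a d \<longleftrightarrow> (L b d \<noteq> L c d)" if "d \<in> ?G - ?T" for d
        by (rule out(4)) (use that in auto)
      show "L a b \<longleftrightarrow> L b a" "L a c \<longleftrightarrow> L c a" "L b c \<longleftrightarrow> L c b"
        by (rule sym; use abc in simp)+
    qed (use fin abc in auto)
    moreover have "card ?T = 3" using abc by simp
    ultimately show "?T = {} \<or> odd (card ?T) \<and> odd (card (?T \<inter> even_part L ?G))" by simp
    show "\<sigma>' (f x) = \<sigma> x" if "x \<in> ?G" for x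
      using that f fG \<sigma> by auto
    \<comment> \<open>One order of each pair suffices; the other follows by symmetry, which holds
      only for distinct vertices.\<close>
    have half: "L' (f x) (f y) \<longleftrightarrow> (L x y \<noteq> (x \<in> ?T \<and> y \<in> ?T))"
      if "x \<in> ?G" "y \<in> G \<or> x = a \<and> y \<in> {b, c} \<or> x = b \<and> y = c" for x y
    proof -
      have "x = a \<or> x = b \<or> x = c \<or> x \<in> G" using that(1) by auto
      then show ?thesis
        using that(2) abc by (elim disjE conjE) (auto simp: f fG toggle out)
    qed
    show "L' (f x) (f y) \<longleftrightarrow> (L x y \<noteq> (x \<in> ?T \<and> y \<in> ?T))"
      if x: "x \<in> ?G" and y: "y \<in> ?G" and xy: "x \<noteq> y" for x y
    proof (cases "y \<in> G \<or> x = a \<and> y \<in> {b, c} \<or> x = b \<and> y = c")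
      case True
      then show ?thesis by (rule half[OF x])
    next
      case False
      then have "x \<in> G \<or> y = a \<and> x \<in> {b, c} \<or> y = b \<and> x = c" using x y xy by auto
      from half[OF y this] have "L' (f y) (f x) \<longleftrightarrow> (L y x \<noteq> (x \<in> ?T \<and> y \<in> ?T))" by blast
      moreover have "L x y \<longleftrightarrow> L y x" by (rule sym[OF x y xy])
      moreover have "L' (f x) (f y) \<longleftrightarrow> L' (f y) (f x)"
      proof (rule sym')
        show "f x \<in> ?G'" "f y \<in> ?G'" using x y f fG by auto
        show "f x \<noteq> f y" using inj_onD[OF bij_betw_imp_inj_on[OF bij] _ x y] xy by blast
      qed
      ultimately show ?thesis by simp
    qed
  qed
qed

text \<open>The graph and hence the sets of summation stay the same. If \<open>c\<close> has even
  degree it lies in the even part, so the last assumption makes it count in one of the two sums,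
  which changes by \<open>2 * \<sigma> c\<close>.\<close>

lemma not_same_writhes_sign_change:
  assumes "finite G" "c \<in> G" "\<sigma> c \<noteq> 0" "\<sigma>' c = - \<sigma> c" "\<And>d. d \<in> G \<Longrightarrow> d \<noteq> c \<Longrightarrow> \<sigma>' d = \<sigma> d"
    and c: "odd_degree L G c \<or> odd_degree L (even_part L G) c"
  shows "\<not> same_writhes L \<sigma> G L \<sigma>' G"
proof -
  have ch: "odd_writhe L \<sigma>' S = odd_writhe L \<sigma> S - 2 * \<sigma> c"
    if "S \<subseteq> G" "c \<in> S" "odd_degree L S c" for S
  proof -
    have "finite S" using that assms finite_subset by auto
    then have "odd_writhe L \<tau> S = \<tau> c + (\<Sum>d\<in>{d \<in> S. odd_degree L S d} - {c}. \<tau> d)" for \<tau>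
      unfolding odd_writhe_def by (intro sum.remove) (use that in auto)
    moreover have "(\<Sum>d\<in>{d \<in> S. odd_degree L S d} - {c}. \<sigma>' d) =
      (\<Sum>d\<in>{d \<in> S. odd_degree L S d} - {c}. \<sigma> d)"
      by (rule sum.cong) (use assms that in auto)
    ultimately show ?thesis using assms by simp
  qed
  show ?thesis
  proof (cases "odd_degree L G c")
    case True
    then show ?thesis using ch[of G] assms by (auto simp: same_writhes_def)
  next
    case False
    then have "c \<in> even_part L G" "even_part L G \<subseteq> G" using assms by (auto simp: even_part_def)
    then show ?thesis using ch[of "even_part L G"] False assms by (auto simp: same_writhes_def)
  qed
qed

section \<open>The interlacement graph of a diagram\<close>

text \<open>Over and under times are definite descriptions; this relation is their usable form and
  can be carried from one diagram to another parameter by parameter.\<close>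

definition crossing_at :: "tdiagram \<Rightarrow> complex \<Rightarrow> real \<Rightarrow> real \<Rightarrow> bool" where
  "crossing_at K c s t \<longleftrightarrow> s \<in> {0..<1} \<and> t \<in> {0..<1} \<and> s \<noteq> t \<and>
     strand K s = c \<and> strand K t = c \<and> s \<in> over K \<and> t \<notin> over K"

text \<open>For four distinct parameters this says that exactly one of \<open>u\<close>, \<open>v\<close> lies between \<open>s\<close> and \<open>t\<close>,
  in whichever order \<open>s\<close> and \<open>t\<close> come.\<close>

definition interlaced :: "real \<Rightarrow> real \<Rightarrow> real \<Rightarrow> real \<Rightarrow> bool" where
  "interlaced s t u v \<longleftrightarrow> (((s < u) \<noteq> (t < u)) \<noteq> ((s < v) \<noteq> (t < v)))"

text \<open>On the diagonal the formula yields true for a crossing with two distinct times, which is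
  why degrees are counted over \<open>S - {c}\<close>.\<close>

definition linked :: "tdiagram \<Rightarrow> complex \<Rightarrow> complex \<Rightarrow> bool" where
  "linked K c d \<longleftrightarrow>
     interlaced (over_time K c) (under_time K c) (over_time K d) (under_time K d)"

abbreviation equal_writhes :: "tdiagram \<Rightarrow> tdiagram \<Rightarrow> bool" where
  "equal_writhes K K' \<equiv>
     same_writhes (linked K) (csign K) (classical_crossings K)
       (linked K') (csign K') (classical_crossings K')"

section \<open>Crossings and their two passages\<close>

lemma twisted_diagram_passages:
  assumes "twisted_diagram K" "s \<in> {0..<1}" "t \<in> {0..<1}" "s \<noteq> t" "strand K s = strand K t"
  shows "passages K (strand K s) = {s, t}" "strand K s \<in> double_points K"
proof -
  have st: "{s, t} \<subseteq> passages K (strand K s)" using assms by (auto simp: passages_def)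
  then show dp: "strand K s \<in> double_points K" using \<open>s \<noteq> t\<close> by (auto simp: double_points_def)
  then have "card (passages K (strand K s)) = 2"
    using assms(1) by (auto simp: twisted_diagram_def)
  then show "passages K (strand K s) = {s, t}"
    using st \<open>s \<noteq> t\<close> by (intro card_subset_eq[symmetric]) (auto intro: card_ge_0_finite)
qed

lemma crossing_at_times:
  assumes "twisted_diagram K" "crossing_at K c s t"
  shows "over_time K c = s" "under_time K c = t" "c \<in> classical_crossings K" "passages K c = {s, t}"
proof -
  have "passages K (strand K s) = {s, t}" "strand K s \<in> double_points K"
    using twisted_diagram_passages[of K s t] assms by (auto simp: crossing_at_def)
  then show "passages K c = {s, t}" "over_time K c = s" "under_time K c = t"
      "c \<in> classical_crossings K"
    using assms(2)
    by (auto simp: crossing_at_def over_time_def under_time_def classical_crossings_def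
        intro!: the_equality)
qed

lemma crossing_at_iff:
  assumes "twisted_diagram K"
  shows "crossing_at K c s t \<longleftrightarrow>
    c \<in> classical_crossings K \<and> s = over_time K c \<and> t = under_time K c"
proof
  assume R: "c \<in> classical_crossings K \<and> s = over_time K c \<and> t = under_time K c"
  then obtain u where u: "u \<in> passages K c" "u \<in> over K" and "c \<in> double_points K"
    by (auto simp: classical_crossings_def)
  then obtain v where v: "v \<in> passages K c" "v \<noteq> u" by (auto simp: double_points_def)
  moreover have "v \<notin> over K"
    using assms u v unfolding twisted_diagram_def by blast
  ultimately have "crossing_at K c u v" using u by (auto simp: crossing_at_def passages_def)
  with crossing_at_times[OF assms this] R show "crossing_at K c s t" by simp
qed (use crossing_at_times[OF assms] in auto)

lemma classical_crossing_at:
  assumes "twisted_diagram K" "c \<in> classical_crossings K"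
  shows "crossing_at K c (over_time K c) (under_time K c)"
  using crossing_at_iff assms by auto

lemma finite_classical_crossings: "twisted_diagram K \<Longrightarrow> finite (classical_crossings K)"
  by (rule finite_subset[of _ "double_points K"])
    (auto simp: classical_crossings_def twisted_diagram_def)

lemma distinct_crossing_times:
  assumes "twisted_diagram K" "c \<in> classical_crossings K" "d \<in> classical_crossings K" "c \<noteq> d"
  shows "over_time K c \<noteq> over_time K d" "over_time K c \<noteq> under_time K d"
    "under_time K c \<noteq> over_time K d" "under_time K c \<noteq> under_time K d"
  using classical_crossing_at[OF assms(1,2)] classical_crossing_at[OF assms(1,3)] \<open>c \<noteq> d\<close>
  by (auto simp: crossing_at_def)

text \<open>Exchanging the crossings negates each of the four comparisons, as no two of the times
  compared coincide, and four negations cancel in the exclusive or.\<close>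

lemma linked_sym:
  assumes "twisted_diagram K" "c \<in> classical_crossings K" "d \<in> classical_crossings K" "c \<noteq> d"
  shows "linked K c d \<longleftrightarrow> linked K d c"
  using distinct_crossing_times[OF assms] unfolding linked_def interlaced_def
  by (smt (verit))

lemma periodic_add_int:
  assumes "\<And>t :: real. f (t + 1) = f t"
  shows "f (t + of_int n) = f t"
proof (induction n rule: int_induct[of _ 0])
  case (step1 i)
  then show ?case using assms[of "t + of_int i"] by (simp add: add.assoc)
next
  case (step2 i)
  then show ?case using assms[of "t + of_int (i - 1)"] by (simp add: add.assoc)
qed simp

lemma periodic_frac:
  assumes "\<And>t :: real. f (t + 1) = f t"
  shows "f (frac t) = f t"
  using periodic_add_int[of f t "- \<lfloor>t\<rfloor>", OF assms] by (simp add: frac_def)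

lemma strand_periodic: "twisted_diagram K \<Longrightarrow> strand K (t + 1) = strand K t"
  by (simp add: twisted_diagram_def closed_immersion_def)

section \<open>Parity of the affine indices\<close>

lemma odd_sum_int_iff_odd_card:
  fixes f :: "'a \<Rightarrow> int"
  assumes "finite A" "\<And>x. x \<in> A \<Longrightarrow> odd (f x)"
  shows "odd (sum f A) \<longleftrightarrow> odd (card A)"
  using assms by (induction A rule: finite_induct) auto

text \<open>The interval is shorter than 1, so each of the two passages of \<open>d\<close> occurs
  in it at most once; the count is odd when exactly one of them does.\<close>

lemma card_crossing_between:
  assumes K: "twisted_diagram K" and ab: "a \<in> {0..<1}" "b \<in> {0..<1}" "a \<noteq> b"
    and d: "crossing_at K d u v" and ne: "u \<noteq> a" "u \<noteq> b" "v \<noteq> a" "v \<noteq> b"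
  shows "finite {t \<in> {a <..< next_time a b}. strand K t = d}"
    "odd (card {t \<in> {a <..< next_time a b}. strand K t = d}) \<longleftrightarrow> interlaced a b u v"
proof -
  \<comment> \<open>\<open>lift x\<close> is the translate of \<open>x\<close> in the window from
    \<open>a\<close> to \<open>a + 1\<close>, which contains the interval.\<close>
  define lift where "lift x = (if a < x then x else x + 1)" for x
  define S where "S x = (if lift x < next_time a b then {lift x} else {})" for x
  have uv: "u \<in> {0..<1}" "v \<in> {0..<1}" "u \<noteq> v" "strand K u = d" "strand K v = d"
    using d by (auto simp: crossing_at_def)
  have "{t \<in> {a <..< next_time a b}. strand K t = d} = S u \<union> S v"
  proof (intro equalityI subsetI)
    fix t assume t: "t \<in> {t \<in> {a <..< next_time a b}. strand K t = d}"
    have "t < a + 1" using t ab by (auto simp: next_time_def split: if_splits)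
    define x where "x = (if t < 1 then t else t - 1)"
    have x: "x \<in> {0..<1}" "lift x = t"
      using t ab \<open>t < a + 1\<close> by (auto simp: x_def lift_def)
    have "strand K x = d" using t strand_periodic[OF K, of "t - 1"] by (auto simp: x_def)
    then have "x \<in> passages K d" using x by (auto simp: passages_def)
    then have "x = u \<or> x = v" using crossing_at_times(4)[OF K d] by auto
    then show "t \<in> S u \<union> S v" using x t by (auto simp: S_def)
  next
    fix t assume "t \<in> S u \<union> S v"
    then have "t < next_time a b" "t = lift u \<or> t = lift v" by (auto simp: S_def split: if_splits)
    then show "t \<in> {t \<in> {a <..< next_time a b}. strand K t = d}"
      using uv ab ne strand_periodic[OF K] by (auto simp: lift_def split: if_splits)
  qed
  moreover have "lift u \<noteq> lift v" using uv by (auto simp: lift_def)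
  \<comment> \<open>If \<open>b < a\<close>, the interval runs through 1 and meets, modulo 1, the
    parameters not between \<open>b\<close> and \<open>a\<close>. This correction is the same for
    \<open>u\<close> and \<open>v\<close> and cancels.\<close>
  moreover have "lift x < next_time a b \<longleftrightarrow> (((a < x) \<noteq> (b < x)) \<noteq> (b < a))"
    if "x \<in> {0..<1}" "x \<noteq> a" "x \<noteq> b" for x
    using that ab by (auto simp: lift_def next_time_def)
  ultimately show "finite {t \<in> {a <..< next_time a b}. strand K t = d}"
    "odd (card {t \<in> {a <..< next_time a b}. strand K t = d}) \<longleftrightarrow> interlaced a b u v"
    using uv ne by (auto simp: S_def interlaced_def)
qed

text \<open>With \<open>S\<close> left open, one computation serves both \<open>ind\<close> (all
  classical crossings) and \<open>zind\<close> (zero crossings). Every term is 1 or -1, so the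
  parity of the sum is that of the number of passages, which are then grouped by crossings.\<close>

lemma odd_index_sum:
  assumes K: "twisted_diagram K" and c: "c \<in> classical_crossings K" and S: "S \<subseteq> classical_crossings K"
  shows "odd (\<Sum>t | t \<in> component_params K c l \<and> strand K t \<in> S.
                (- 1) ^ eps K t * csign K (strand K t)) \<longleftrightarrow> odd_degree (linked K) S c"
proof -
  define a where "a = (if l = 0 then over_time K c else under_time K c)"
  define b where "b = (if l = 0 then under_time K c else over_time K c)"
  define P where "P d = {t \<in> {a <..< next_time a b}. strand K t = d}" for d
  have co: "crossing_at K c (over_time K c) (under_time K c)"
    by (rule classical_crossing_at[OF K c])
  have ab: "a \<in> {0..<1}" "b \<in> {0..<1}" "a \<noteq> b"
    using co by (auto simp: a_def b_def crossing_at_def)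
  have ps: "passages K c = {a, b}" using crossing_at_times(4)[OF K co] by (auto simp: a_def b_def)
  \<comment> \<open>The interval is open and ends at the other passage of \<open>c\<close>, so
    \<open>c\<close> itself is not met; this matches \<open>S - {c}\<close> in the degree.\<close>
  have Pc: "P c = {}"
  proof (rule ccontr)
    assume "P c \<noteq> {}"
    then obtain t where t: "a < t" "t < next_time a b" "strand K t = c" by (auto simp: P_def)
    have "t < a + 1" using t ab by (auto simp: next_time_def split: if_splits)
    define x where "x = (if t < 1 then t else t - 1)"
    have "strand K x = c" using t strand_periodic[OF K, of "t - 1"] by (auto simp: x_def)
    then have "x \<in> passages K c" using t ab \<open>t < a + 1\<close> by (auto simp: passages_def x_def)
    then have "x = a \<or> x = b" using ps by auto
    then show False using t ab \<open>t < a + 1\<close> by (auto simp: x_def next_time_def split: if_splits)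
  qed
  have Pd: "finite (P d) \<and> (odd (card (P d)) \<longleftrightarrow> linked K c d)" if "d \<in> S - {c}" for d
  proof -
    have d: "d \<in> classical_crossings K" "c \<noteq> d" using that S by auto
    \<comment> \<open>The label \<open>l\<close> only exchanges \<open>a\<close> and
      \<open>b\<close>, which \<open>interlaced\<close> ignores, so both components give the same
      parity.\<close>
    have "interlaced a b u v \<longleftrightarrow> interlaced (over_time K c) (under_time K c) u v" for u v
      by (auto simp: a_def b_def interlaced_def)
    then show ?thesis
      using card_crossing_between[OF K ab classical_crossing_at[OF K d(1)]]
        distinct_crossing_times[OF K c d] unfolding P_def linked_def
      by (auto simp: a_def b_def split: if_splits)
  qed
  have fS: "finite S" using finite_classical_crossings[OF K] S finite_subset by blast
  have A: "{t. t \<in> component_params K c l \<and> strand K t \<in> S} = (\<Union>d \<in> S - {c}. P d)"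
    using Pc by (auto simp: component_params_def P_def a_def b_def)
  have "odd (\<Sum>t | t \<in> component_params K c l \<and> strand K t \<in> S.
          (- 1) ^ eps K t * csign K (strand K t)) \<longleftrightarrow> odd (card (\<Union>d \<in> S - {c}. P d))"
    unfolding A by (rule odd_sum_int_iff_odd_card) (use fS Pd in \<open>auto simp: csign_def\<close>)
  also have "card (\<Union>d \<in> S - {c}. P d) = (\<Sum>d \<in> S - {c}. card (P d))"
    by (rule card_UN_disjoint) (use fS Pd in \<open>auto simp: P_def\<close>)
  also have "odd \<dots> \<longleftrightarrow> odd (\<Sum>d \<in> S - {c}. of_bool (linked K c d) :: nat)"
    by (rule odd_sum_cong) (use fS Pd in auto)
  finally show ?thesis by (simp add: odd_degree_def)
qed

lemma zero_crossings_eq: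
  assumes "twisted_diagram K"
  shows "zero_crossings K = even_part (linked K) (classical_crossings K)"
  using odd_index_sum[OF assms _ order.refl] unfolding zero_crossings_def even_part_def ind_def
  by auto

lemma crossing_change_writhes:
  assumes K: "twisted_diagram K" and c: "c \<in> classical_crossings K"
    and odd: "c \<notin> zero_crossings K \<or> odd (zind 0 c K)"
  shows "\<not> equal_writhes K (crossing_change K c)"
proof -
  let ?K = "crossing_change K c"
  have pa: "passages ?K p = passages K p" for p
    by (simp add: passages_def crossing_change_def)
  have st: "strand ?K = strand K" by (simp add: crossing_change_def)
  have ov: "t \<in> over ?K \<longleftrightarrow> (if p = c then t \<notin> over K else t \<in> over K)" if "t \<in> passages K p" for t p
    using that by (auto simp: passages_def crossing_change_def)
  note co = classical_crossing_at[OF K c]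
  have sw: "over_time ?K c = under_time K c" "under_time ?K c = over_time K c"
    unfolding over_time_def under_time_def pa using ov[of _ c]
    by (auto intro!: arg_cong[where f = The])
  have same: "over_time ?K d = over_time K d" "under_time ?K d = under_time K d" if "d \<noteq> c" for d
    unfolding over_time_def under_time_def pa using ov[of _ d] that
    by (auto intro!: arg_cong[where f = The])
  have cc: "classical_crossings ?K = classical_crossings K"
  proof -
    have dp: "double_points ?K = double_points K" by (simp add: double_points_def pa)
    have "p \<in> classical_crossings ?K \<longleftrightarrow> p \<in> classical_crossings K" for p
    proof (cases "p = c")
      case True
      have "under_time K c \<in> passages K c" "under_time K c \<notin> over K"
        using co by (auto simp: crossing_at_def passages_def)
      then show ?thesis using True c ov[of _ c]
        unfolding classical_crossings_def dp pa by auto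
    next
      case False
      then show ?thesis using ov[of _ p] unfolding classical_crossings_def dp pa by auto
    qed
    then show ?thesis by blast
  qed
  have lk: "linked ?K = linked K"
  proof (intro ext)
    fix d e show "linked ?K d e = linked K d e"
      using sw same unfolding linked_def interlaced_def by (cases "d = c"; cases "e = c") auto
  qed
  have det: "det2 x y = - det2 y x" for x y by (simp add: det2_def)
  let ?v = "\<lambda>t. vector_derivative (strand K) (at t)"
  \<comment> \<open>A vanishing determinant would give sign -1 both before and after the change;
    transversality excludes it.\<close>
  have "det2 (?v (over_time K c)) (?v (under_time K c)) \<noteq> 0"
    using K co unfolding twisted_diagram_def crossing_at_def passages_def by blast
  then have "csign ?K c = - csign K c"
    unfolding csign_def st sw using det[of "?v (over_time K c)"] by auto
  moreover have "csign ?K d = csign K d" if "d \<noteq> c" for d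
    unfolding csign_def st using same[OF that] by simp
  moreover have "odd_degree (linked K) (classical_crossings K) c \<or>
      odd_degree (linked K) (even_part (linked K) (classical_crossings K)) c"
  proof (cases "c \<in> zero_crossings K")
    case True
    have "zero_crossings K \<subseteq> classical_crossings K" by (auto simp: zero_crossings_def)
    from odd_index_sum[OF K c this, of 0] True odd show ?thesis
      unfolding zind_def zero_crossings_eq[OF K] by auto
  next
    case False
    then show ?thesis using c zero_crossings_eq[OF K] by (auto simp: even_part_def)
  qed
  ultimately show ?thesis unfolding cc lk
    using finite_classical_crossings[OF K] c
    by (intro not_same_writhes_sign_change[where c = c]) (auto simp: csign_def)
qed

section \<open>Isotopies and changes of parameter\<close>

lemma strand_differentiable:
  assumes "twisted_diagram K"
  shows "(strand K has_vector_derivative vector_derivative (strand K) (at t)) (at t)"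
proof -
  have "strand K differentiable at t"
    using assms by (auto simp: twisted_diagram_def closed_immersion_def C1_differentiable_on_eq)
  then show ?thesis by (simp add: vector_derivative_works)
qed

text \<open>The factor is the determinant of \<open>L\<close> in the real basis 1,
  \<open>\<i>\<close>, so this is multiplicativity of the determinant.\<close>

lemma det2_linear:
  assumes "linear L"
  shows "det2 (L u) (L v) = det2 (L 1) (L \<i>) * det2 u v"
proof -
  have "L z = Re z *\<^sub>R L 1 + Im z *\<^sub>R L \<i>" for z
  proof -
    have "z = Re z *\<^sub>R 1 + Im z *\<^sub>R \<i>" by (simp add: complex_eq_iff)
    then have "L z = L (Re z *\<^sub>R 1 + Im z *\<^sub>R \<i>)" by (rule arg_cong)
    then show ?thesis using assms by (simp add: linear_add linear_scale)
  qed
  from this[of u] this[of v] show ?thesis by (simp add: det2_def algebra_simps)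
qed

lemma det2_injective:
  assumes "linear L" "inj L"
  shows "det2 (L 1) (L \<i>) \<noteq> 0"
proof
  assume 0: "det2 (L 1) (L \<i>) = 0"
  have L: "x *\<^sub>R L 1 + y *\<^sub>R L \<i> = 0 \<Longrightarrow> x = 0 \<and> y = 0" for x y
  proof -
    assume "x *\<^sub>R L 1 + y *\<^sub>R L \<i> = 0"
    then have "L (x *\<^sub>R 1 + y *\<^sub>R \<i>) = L 0"
      using \<open>linear L\<close> by (simp add: linear_add linear_scale linear_0)
    then have "x *\<^sub>R 1 + y *\<^sub>R \<i> = 0" using inj_eq[OF \<open>inj L\<close>] by blast
    then show "x = 0 \<and> y = 0" by (simp add: complex_eq_iff)
  qed
  \<comment> \<open>In each combination one coordinate cancels identically and the other is the
    determinant up to sign. By independence the coefficients vanish, which gives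
    \<open>L 1 = 0\<close>.\<close>
  have "Re (L \<i>) *\<^sub>R L 1 + (- Re (L 1)) *\<^sub>R L \<i> = 0" "Im (L \<i>) *\<^sub>R L 1 + (- Im (L 1)) *\<^sub>R L \<i> = 0"
    using 0 by (auto simp: complex_eq_iff det2_def algebra_simps)
  from this[THEN L] have "L 1 = 0" by (simp add: complex_eq_iff)
  then show False using L[of 1 0] by simp
qed

text \<open>The Jacobian determinant is 1 at time 0, depends continuously on time and never
  vanishes, hence stays positive. This is what preserves the signs of crossings.\<close>

lemma plane_isotopy_orientation:
  assumes "plane_isotopy H"
  obtains L where "\<And>z. (H 1 has_derivative L z) (at z)" "\<And>z. linear (L z)"
    "\<And>z. 0 < det2 (L z 1) (L z \<i>)"
proof -
  obtain H' :: "real \<Rightarrow> complex \<Rightarrow> complex \<Rightarrow>\<^sub>L complex" where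
    cont: "continuous_on ({0..1} \<times> UNIV) (\<lambda>(s, z). H' s z)" and
    der: "\<And>s z. s \<in> {0..1} \<Longrightarrow> (H s has_derivative blinfun_apply (H' s z)) (at z)" and
    inj: "\<And>s z. s \<in> {0..1} \<Longrightarrow> inj (blinfun_apply (H' s z))"
    using assms unfolding plane_isotopy_def by blast
  have lin: "linear (blinfun_apply (H' s z))" for s z
    by (simp add: blinfun.bounded_linear_right bounded_linear.linear)
  have "0 < det2 (H' 1 z 1) (H' 1 z \<i>)" for z
  proof (rule ccontr)
    assume neg: "\<not> 0 < det2 (H' 1 z 1) (H' 1 z \<i>)"
    have "H 0 = (\<lambda>z. z)" using assms by (auto simp: plane_isotopy_def)
    then have "blinfun_apply (H' 0 z) = (\<lambda>w. w)"
      using has_derivative_unique[OF der[of 0 z], of "\<lambda>w. w"] by simp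
    then have 0: "det2 (H' 0 z 1) (H' 0 z \<i>) = 1" by (simp add: det2_def)
    have "continuous_on {0..1} (\<lambda>s. case (s, z) of (s, z) \<Rightarrow> H' s z)"
      by (rule continuous_on_compose2[OF cont]) (auto intro!: continuous_intros)
    then have c: "continuous_on {0..1} (\<lambda>s. H' s z)" by simp
    have "continuous_on {0..1} (\<lambda>s. det2 (H' s z 1) (H' s z \<i>))"
      unfolding det2_def by (intro continuous_intros c)
    from IVT2'[OF _ _ _ this, of 0] neg 0
    obtain s where "s \<in> {0..1}" "det2 (H' s z 1) (H' s z \<i>) = 0" by force
    then show False using det2_injective[OF lin inj] by blast
  qed
  then show ?thesis using that[of "\<lambda>z. blinfun_apply (H' 1 z)"] der lin by auto
qed

text \<open>Only the points move, under \<open>H 1\<close>; the times of the crossings, and with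
  them interlacement, stay the same.\<close>

lemma planar_isotopic_writhes:
  assumes K: "twisted_diagram K" and K': "twisted_diagram K'" and iso: "planar_isotopic K K'"
  shows "equal_writhes K K'"
proof -
  obtain H where H: "plane_isotopy H" and st: "strand K' = H 1 \<circ> strand K" and ov: "over K' = over K"
    using iso by (auto simp: planar_isotopic_def)
  have inj: "inj (H 1)" using H by (auto simp: plane_isotopy_def bij_def)
  obtain L where der: "\<And>z. (H 1 has_derivative L z) (at z)" and lin: "\<And>z. linear (L z)"
    and pos: "\<And>z. 0 < det2 (L z 1) (L z \<i>)"
    using plane_isotopy_orientation[OF H] by blast
  have cr: "crossing_at K' (H 1 c) s t \<longleftrightarrow> crossing_at K c s t" for c s t
    using inj by (auto simp: crossing_at_def st ov inj_eq)
  have tm: "over_time K' (H 1 c) = over_time K c" "under_time K' (H 1 c) = under_time K c"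
    if "c \<in> classical_crossings K" for c
    using cr crossing_at_times[OF K'] classical_crossing_at[OF K that] by blast+
  have "classical_crossings K' = H 1 ` classical_crossings K"
  proof (intro equalityI subsetI)
    fix q assume "q \<in> classical_crossings K'"
    from classical_crossing_at[OF K' this] obtain s t where q: "crossing_at K' q s t" by blast
    then have "q = H 1 (strand K s)" by (auto simp: crossing_at_def st)
    with q cr crossing_at_times(3)[OF K] show "q \<in> H 1 ` classical_crossings K" by blast
  next
    fix q assume "q \<in> H 1 ` classical_crossings K"
    then obtain c where "q = H 1 c" "c \<in> classical_crossings K" by blast
    then show "q \<in> classical_crossings K'"
      using cr crossing_at_times(3)[OF K'] classical_crossing_at[OF K] by blast
  qed
  then have bij: "bij_betw (H 1) (classical_crossings K) (classical_crossings K')"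
    using inj by (auto simp: bij_betw_def inj_on_def inj_def)
  have vd: "vector_derivative (strand K') (at t) = L (strand K t) (vector_derivative (strand K) (at t))"
    for t
    unfolding st
    using vector_derivative_diff_chain_within[of "strand K" _ t UNIV "H 1"]
      strand_differentiable[OF K] der has_derivative_at_withinI vector_derivative_at by metis
  have sg: "csign K' (H 1 c) = csign K c" if c: "c \<in> classical_crossings K" for c
  proof -
    have "strand K (over_time K c) = c" "strand K (under_time K c) = c"
      using classical_crossing_at[OF K c] by (auto simp: crossing_at_def)
    then show ?thesis unfolding csign_def tm[OF c] vd
      using pos[of c] det2_linear[OF lin[of c], of "vector_derivative (strand K) (at (over_time K c))"
          "vector_derivative (strand K) (at (under_time K c))"] zero_less_mult_pos mult_pos_pos
      by metis
  qed
  show ?thesis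
    by (rule same_writhes_iso[OF finite_classical_crossings[OF K] bij])
      (use tm sg in \<open>auto simp: linked_def\<close>)
qed

section \<open>Changes of parameter\<close>

lemma vector_derivative_periodic:
  fixes g :: "real \<Rightarrow> 'a :: real_normed_vector"
  assumes "\<And>t. g (t + 1) = g t" "\<And>t. (g has_vector_derivative vector_derivative g (at t)) (at t)"
  shows "vector_derivative g (at (t + 1)) = vector_derivative g (at t)"
proof -
  have "((\<lambda>t. t + 1) has_vector_derivative 1) (at t :: real filter)"
    by (auto intro!: derivative_eq_intros simp: has_vector_derivative_def)
  from vector_diff_chain_at[OF this, of g] assms(2)[of "t + 1"]
  have "((g \<circ> (\<lambda>t. t + 1)) has_vector_derivative vector_derivative g (at (t + 1))) (at t)"
    by simp
  moreover have "g \<circ> (\<lambda>t. t + 1) = g" using assms by auto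
  ultimately show ?thesis using vector_derivative_at by metis
qed

text \<open>On \<open>{0..<1}\<close> the map \<open>frac \<circ> h\<close> is a rotation of the circular order, so it changes the truth
  values of \<open>s < u\<close> and \<open>s < v\<close> in pairs.\<close>

lemma interlaced_frac:
  fixes h :: "real \<Rightarrow> real"
  assumes mono: "strict_mono h" and per: "\<And>t. h (t + 1) = h t + 1"
    and "s \<in> {0..<1}" "t \<in> {0..<1}" "u \<in> {0..<1}" "v \<in> {0..<1}"
    and "s \<noteq> u" "s \<noteq> v" "t \<noteq> u" "t \<noteq> v"
  shows "interlaced (frac (h s)) (frac (h t)) (frac (h u)) (frac (h v)) \<longleftrightarrow> interlaced s t u v"
proof -
  \<comment> \<open>On \<open>{0..<1}\<close> the values of \<open>h\<close> lie between
    \<open>h 0\<close> and \<open>h 0 + 1\<close>, so their floors take at most two values;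
    \<open>w x\<close> says that \<open>h x\<close> has reached the second.\<close>
  define w where "w x \<longleftrightarrow> \<lfloor>h 0\<rfloor> + 1 \<le> h x" for x
  have fr: "frac (h x) = h x - \<lfloor>h 0\<rfloor> - of_bool (w x)" if "x \<in> {0..<1}" for x
  proof -
    have "h 0 \<le> h x" "h x < h 0 + 1"
      using that strict_mono_less_eq[OF mono, of 0 x] strict_mono_less[OF mono, of x 1] per[of 0]
      by auto
    then have "\<lfloor>h x\<rfloor> = \<lfloor>h 0\<rfloor> + of_bool (w x)"
      unfolding w_def by (cases "\<lfloor>h 0\<rfloor> + 1 \<le> h x") (simp_all, linarith+)
    then show ?thesis by (simp add: frac_def)
  qed
  \<comment> \<open>If exactly one of the two has wrapped around, it is the later one, and reduction
    modulo 1 puts it first.\<close>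
  have lt: "frac (h x) < frac (h y) \<longleftrightarrow> ((x < y) \<noteq> (w x \<noteq> w y))"
    if "x \<in> {0..<1}" "y \<in> {0..<1}" "x \<noteq> y" for x y
  proof -
    have "h x < h 0 + 1" "h y < h 0 + 1" "h 0 \<le> h x" "h 0 \<le> h y"
      using that strict_mono_less_eq[OF mono, of 0] strict_mono_less[OF mono, of _ 1] per[of 0]
      by auto
    then show ?thesis
      using fr that strict_mono_less[OF mono, of x y] unfolding w_def by (auto simp: of_bool_def)
  qed
  show ?thesis
    using lt[of s u] lt[of s v] lt[of t u] lt[of t v] assms(3-) unfolding interlaced_def by argo
qed

text \<open>The crossings are the same points; their times in \<open>K\<close> are the images under
  \<open>frac \<circ> h\<close> of those in \<open>K'\<close>. Tangent vectors are only multiplied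
  by positive factors.\<close>

lemma reparametrized_writhes:
  assumes K: "twisted_diagram K" and K': "twisted_diagram K'" and rep: "reparametrized K K'"
  shows "equal_writhes K K'"
proof -
  obtain h where hC: "h C1_differentiable_on UNIV" and h': "\<And>t. 0 < vector_derivative h (at t)"
    and per: "\<And>t. h (t + 1) = h t + 1"
    and st: "strand K' = strand K \<circ> h" and ov: "over K' = h -` over K"
    using rep by (auto simp: reparametrized_def)
  have hd: "(h has_vector_derivative vector_derivative h (at t)) (at t)" for t
    using hC by (auto simp: C1_differentiable_on_eq vector_derivative_works[symmetric])
  have mono: "strict_mono h"
  proof (rule strict_monoI)
    fix x y :: real assume "x < y"
    then show "h x < h y"
      by (rule DERIV_pos_imp_increasing)
        (use hd h' in \<open>auto simp: has_real_derivative_iff_has_vector_derivative\<close>)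
  qed
  have cont: "continuous_on S h" for S
    using hd by (intro continuous_at_imp_continuous_on) (auto intro: has_vector_derivative_continuous)
  have surj: "\<exists>u \<in> {0..<1}. frac (h u) = t" if "t \<in> {0..<1}" for t
  proof -
    \<comment> \<open>An integer shift moves \<open>t\<close> to a value of \<open>h\<close> on
      \<open>{0..<1}\<close>, and \<open>frac\<close> undoes the shift.\<close>
    define n where "n = \<lfloor>t - h 0\<rfloor>"
    have n: "h 0 \<le> t - n" "t - n < h 1"
      using per[of 0] unfolding n_def by (auto, linarith+)
    then obtain u where u: "0 \<le> u" "u \<le> 1" "h u = t - n"
      using IVT'[of h 0 "t - n" 1, OF _ _ _ cont] by auto
    then have "u \<noteq> 1" using n by auto
    moreover have "frac (h u) = t" using that u frac_unique_iff[of "h u" t] by (auto simp: frac_eq)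
    ultimately show ?thesis using u by force
  qed
  have stf: "strand K (frac x) = strand K x" for x
    by (rule periodic_frac) (rule strand_periodic[OF K])
  have ovf: "frac x \<in> over K \<longleftrightarrow> x \<in> over K" for x
    by (rule periodic_frac[where f = "\<lambda>x. x \<in> over K"]) (use K in \<open>auto simp: twisted_diagram_def\<close>)
  let ?v = "\<lambda>K t. vector_derivative (strand K) (at t)"
  have vdf: "?v K (frac x) = ?v K x" for x
    by (rule periodic_frac, rule vector_derivative_periodic)
      (use strand_periodic[OF K] strand_differentiable[OF K] in auto)
  have vd: "?v K' t = vector_derivative h (at t) *\<^sub>R ?v K (frac (h t))" for t
    unfolding st vdf
    by (rule vector_derivative_at, rule vector_diff_chain_at) (use hd strand_differentiable[OF K] in auto)
  have fr01: "frac x \<in> {0..<1}" for x :: real by (simp add: frac_lt_1)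
  have cr: "crossing_at K c (frac (h s)) (frac (h t))" if "crossing_at K' c s t" for c s t
  proof -
    have "frac (h s) \<in> over K" "frac (h t) \<notin> over K" "frac (h s) \<noteq> frac (h t)"
      using that ovf[of "h s"] ovf[of "h t"] by (auto simp: crossing_at_def ov)
    then show ?thesis using that fr01 stf by (auto simp: crossing_at_def st)
  qed
  have tm: "over_time K c = frac (h (over_time K' c))" "under_time K c = frac (h (under_time K' c))"
    and cK: "c \<in> classical_crossings K" if "c \<in> classical_crossings K'" for c
    using crossing_at_times[OF K cr[OF classical_crossing_at[OF K' that]]] by auto
  have cc: "classical_crossings K' = classical_crossings K"
  proof (intro equalityI subsetI)
    fix c assume "c \<in> classical_crossings K"
    from classical_crossing_at[OF K this] obtain s t where c: "crossing_at K c s t" by blast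
    then obtain u v where uv: "u \<in> {0..<1}" "v \<in> {0..<1}" "frac (h u) = s" "frac (h v) = t"
      using surj[of s] surj[of t] by (auto simp: crossing_at_def)
    then have "crossing_at K' c u v"
      using c stf ovf by (auto simp: crossing_at_def st ov)
    then show "c \<in> classical_crossings K'" using crossing_at_times(3)[OF K'] by blast
  qed (use cK in auto)
  have sg: "csign K' c = csign K c" if c: "c \<in> classical_crossings K'" for c
  proof -
    have "det2 (x *\<^sub>R p) (y *\<^sub>R q) = (x * y) * det2 p q" for x y p q
      by (simp add: det2_def algebra_simps)
    moreover have "0 < vector_derivative h (at x) * vector_derivative h (at y) * r \<longleftrightarrow> 0 < r" for x y r
      using h' by (metis mult_pos_pos zero_less_mult_pos)
    ultimately show ?thesis unfolding csign_def tm[OF c] vd by simp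
  qed
  have lk: "linked K c d \<longleftrightarrow> linked K' c d"
    if c: "c \<in> classical_crossings K'" and d: "d \<in> classical_crossings K'" and ne: "c \<noteq> d" for c d
    unfolding linked_def tm[OF c] tm[OF d]
    using classical_crossing_at[OF K' c] classical_crossing_at[OF K' d]
      distinct_crossing_times[OF K' c d ne]
    by (intro interlaced_frac mono per) (auto simp: crossing_at_def)
  show ?thesis unfolding cc[symmetric]
    by (rule same_writhes_iso[OF finite_classical_crossings[OF K'], of id])
      (use lk sg in auto)
qed

section \<open>Local moves\<close>

text \<open>The arcs are closed so that their complement is open: off them the two strands agree
  near each parameter and not merely at it, which is needed for equal tangents.\<close>

definition closed_arcs :: "(real \<times> real) list \<Rightarrow> real set" where
  "closed_arcs Is = (\<Union>I \<in> set Is. {fst I..snd I})"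

lemma local_change_arcs:
  assumes "local_change K K' Is"
  shows "closed_arcs Is = arc_params Is \<union> arc_ends Is" "closed_arcs Is \<subseteq> {0<..<1}"
proof -
  have I: "0 < fst I" "fst I < snd I" "snd I < 1" if "I \<in> set Is" for I
    using assms that unfolding local_change_def by blast+
  have "{fst I..snd I} = {fst I<..<snd I} \<union> {fst I, snd I}" if "I \<in> set Is" for I
    using I[OF that] by auto
  then show "closed_arcs Is = arc_params Is \<union> arc_ends Is"
    unfolding closed_arcs_def arc_params_def arc_ends_def open_arc_def by blast
  show "closed_arcs Is \<subseteq> {0<..<1}"
    using I unfolding closed_arcs_def by fastforce
qed

text \<open>Both passages go through the same point, so they lie in the interior together or not at
  all. A crossing at an arc end would be a frontier point met at two arc ends, against
  injectivity.\<close>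

lemma meets_disc_inD:
  assumes "meets_disc_in K D Is" "crossing_at K c s t"
  shows "s \<in> arc_params Is \<longleftrightarrow> c \<in> interior D" "t \<in> arc_params Is \<longleftrightarrow> c \<in> interior D"
    "\<not> (s \<in> arc_ends Is \<or> t \<in> arc_ends Is)"
proof -
  have st: "s \<in> {0..<1}" "t \<in> {0..<1}" "s \<noteq> t" "strand K s = c" "strand K t = c"
    using assms(2) by (auto simp: crossing_at_def)
  then show "s \<in> arc_params Is \<longleftrightarrow> c \<in> interior D" "t \<in> arc_params Is \<longleftrightarrow> c \<in> interior D"
    using assms(1) unfolding meets_disc_in_def by metis+
  have "s \<in> arc_ends Is \<longleftrightarrow> t \<in> arc_ends Is"
    using assms(1) st unfolding meets_disc_in_def by metis
  moreover have "\<not> (s \<in> arc_ends Is \<and> t \<in> arc_ends Is)"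
    using assms(1) st unfolding meets_disc_in_def inj_on_def by metis
  ultimately show "\<not> (s \<in> arc_ends Is \<or> t \<in> arc_ends Is)" by blast
qed

lemma local_change_outside:
  assumes "local_change K K' Is" "t \<in> {0..<1}" "t \<notin> arc_params Is"
  shows "strand K' t = strand K t" "t \<in> over K' \<longleftrightarrow> t \<in> over K"
proof -
  have "\<forall>t \<in> {0..<1} - arc_params Is.
      strand K' t = strand K t \<and> (t \<in> over K' \<longleftrightarrow> t \<in> over K) \<and> (t \<in> bars K' \<longleftrightarrow> t \<in> bars K)"
    using assms(1) unfolding local_change_def by (elim conjE)
  then show "strand K' t = strand K t" "t \<in> over K' \<longleftrightarrow> t \<in> over K" using assms(2,3) by auto
qed

lemma local_change_sym:
  assumes "local_change K K' Is"
  shows "local_change K' K Is"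
proof -
  have "\<forall>t \<in> {0..<1} - arc_params Is.
      strand K' t = strand K t \<and> (t \<in> over K' \<longleftrightarrow> t \<in> over K) \<and> (t \<in> bars K' \<longleftrightarrow> t \<in> bars K)"
    using assms unfolding local_change_def by (elim conjE)
  then have "\<forall>t \<in> {0..<1} - arc_params Is.
      strand K t = strand K' t \<and> (t \<in> over K \<longleftrightarrow> t \<in> over K') \<and> (t \<in> bars K \<longleftrightarrow> t \<in> bars K')"
    by (simp only: eq_commute)
  moreover have "\<exists>D. D homeomorphic cball (0 :: complex) 1 \<and> meets_disc_in K' D Is \<and> meets_disc_in K D Is"
    using assms unfolding local_change_def by (elim conjE exE) (intro exI conjI)
  ultimately show ?thesis
    using assms unfolding local_change_def by (elim conjE) (intro conjI)
qed

lemma local_change_derivative: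
  assumes K: "twisted_diagram K" and K': "twisted_diagram K'" and lc: "local_change K K' Is"
    and t: "t \<in> {0..<1} - closed_arcs Is"
  shows "vector_derivative (strand K') (at t) = vector_derivative (strand K) (at t)"
proof -
  \<comment> \<open>Every neighbourhood of \<open>t = 0\<close> contains negative parameters; there
    agreement comes from periodicity, provided the arcs shifted by -1 are avoided too.\<close>
  define U where "U = {-1 <..< 1} - closed_arcs Is - (\<lambda>x. x - 1) ` closed_arcs Is"
  have cl: "closed (closed_arcs Is)" unfolding closed_arcs_def by auto
  have "open U" unfolding U_def
    using cl closed_translation_subtract[OF cl, of 1] by (intro open_Diff) auto
  moreover have "t \<in> U" using t local_change_arcs[OF lc] by (auto simp: U_def)
  moreover have "strand K' x = strand K x" if "x \<in> U" for x
  proof -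
    have eq: "strand K' y = strand K y" if "y \<in> {0..<1}" "y \<notin> closed_arcs Is" for y
      using local_change_outside(1)[OF lc] that local_change_arcs(1)[OF lc] by auto
    show ?thesis
    proof (cases "0 \<le> x")
      case True
      then show ?thesis using eq that by (auto simp: U_def)
    next
      case False
      have "x + 1 \<notin> closed_arcs Is"
      proof
        assume "x + 1 \<in> closed_arcs Is"
        then have "(x + 1) - 1 \<in> (\<lambda>x. x - 1) ` closed_arcs Is" by (rule imageI)
        then show False using that by (simp add: U_def)
      qed
      then have "strand K' (x + 1) = strand K (x + 1)"
        using eq[of "x + 1"] False that by (auto simp: U_def)
      then show ?thesis using strand_periodic[OF K] strand_periodic[OF K'] by simp
    qed
  qed
  ultimately have "eventually (\<lambda>x. strand K' x = strand K x) (nhds t)"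
    unfolding eventually_nhds by blast
  then show ?thesis by (intro vector_derivative_cong_eq) auto
qed

lemma outer_crossing:
  assumes lc: "local_change K K' Is" and D: "meets_disc_in K D Is"
    and c: "crossing_at K c s t" "c \<notin> interior D"
  shows "crossing_at K' c s t" "s \<notin> closed_arcs Is" "t \<notin> closed_arcs Is"
proof -
  have A: "s \<notin> arc_params Is" "t \<notin> arc_params Is"
    using meets_disc_inD[OF D c(1)] c(2) by auto
  then show "s \<notin> closed_arcs Is" "t \<notin> closed_arcs Is"
    using meets_disc_inD(3)[OF D c(1)] local_change_arcs(1)[OF lc] by auto
  show "crossing_at K' c s t"
    using local_change_outside[OF lc, of s] local_change_outside[OF lc, of t] c(1) A
    by (auto simp: crossing_at_def)
qed

lemma tangle_classical_iff:
  assumes "tangle K Is C V B"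
  shows "(s, t) \<in> C \<longleftrightarrow> s \<in> arc_params Is \<and> t \<in> arc_params Is \<and> s \<noteq> t \<and>
    strand K s = strand K t \<and> s \<in> over K \<and> t \<notin> over K"
proof -
  have "C = {(s, t). s \<in> arc_params Is \<and> t \<in> arc_params Is \<and> s \<noteq> t \<and> strand K s = strand K t \<and>
              s \<in> over K \<and> t \<notin> over K}"
    using assms unfolding tangle_def by simp
  then show ?thesis by simp
qed

lemma tangle_crossing:
  assumes lc: "local_change K K' Is" and tg: "tangle K Is C V B" and st: "(s, t) \<in> C"
  shows "crossing_at K (strand K s) s t" "s \<in> arc_params Is"
proof -
  have "s \<in> arc_params Is" "t \<in> arc_params Is" "s \<noteq> t" "strand K s = strand K t" "s \<in> over K" "t \<notin> over K"
    using st by (auto simp: tangle_classical_iff[OF tg])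
  moreover have "arc_params Is \<subseteq> {0<..<1}" using local_change_arcs[OF lc] by auto
  ultimately show "crossing_at K (strand K s) s t" "s \<in> arc_params Is"
    by (auto simp: crossing_at_def)
qed

lemma classical_crossings_decomposition:
  assumes K: "twisted_diagram K" and lc: "local_change K K' Is" and tg: "tangle K Is C V B"
    and D: "meets_disc_in K D Is"
  shows "classical_crossings K =
      {c \<in> classical_crossings K. c \<notin> interior D} \<union> (\<lambda>(s, t). strand K s) ` C"
    "(\<lambda>(s, t). strand K s) ` C \<subseteq> interior D"
proof -
  show sub: "(\<lambda>(s, t). strand K s) ` C \<subseteq> interior D"
  proof clarify
    fix s t assume "(s, t) \<in> C"
    from tangle_crossing[OF lc tg this] show "strand K s \<in> interior D"
      using meets_disc_inD(1)[OF D] by blast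
  qed
  have "c \<in> (\<lambda>(s, t). strand K s) ` C" if c: "c \<in> classical_crossings K" "c \<in> interior D" for c
  proof -
    from classical_crossing_at[OF K c(1)] obtain s t where st: "crossing_at K c s t" by blast
    then have "s \<in> arc_params Is" "t \<in> arc_params Is"
      using meets_disc_inD[OF D st] c by auto
    then have "(s, t) \<in> C" using st by (auto simp: tangle_classical_iff[OF tg] crossing_at_def)
    moreover have "c = strand K s" using st by (simp add: crossing_at_def)
    ultimately show ?thesis by force
  qed
  moreover have "(\<lambda>(s, t). strand K s) ` C \<subseteq> classical_crossings K"
  proof clarify
    fix s t assume "(s, t) \<in> C"
    from crossing_at_times(3)[OF K tangle_crossing(1)[OF lc tg this]]
    show "strand K s \<in> classical_crossings K" .
  qed
  ultimately show "classical_crossings K =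
      {c \<in> classical_crossings K. c \<notin> interior D} \<union> (\<lambda>(s, t). strand K s) ` C" by blast
qed

text \<open>This is the common frame for the moves: \<open>G\<close> consists of the crossings
  outside the interior of the disc, so that each move only has to treat the crossings listed in
  \<open>C\<close> and \<open>C'\<close>.\<close>

lemma local_change_crossings:
  assumes K: "twisted_diagram K" and K': "twisted_diagram K'" and lc: "local_change K K' Is"
    and tg: "tangle K Is C V B" and tg': "tangle K' Is C' V' B'"
  obtains G where
    "classical_crossings K = G \<union> (\<lambda>(s, t). strand K s) ` C"
    "G \<inter> (\<lambda>(s, t). strand K s) ` C = {}"
    "classical_crossings K' = G \<union> (\<lambda>(s, t). strand K' s) ` C'"
    "G \<inter> (\<lambda>(s, t). strand K' s) ` C' = {}"
    "\<And>c. c \<in> G \<Longrightarrow> over_time K' c = over_time K c \<and> under_time K' c = under_time K c"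
    "\<And>c. c \<in> G \<Longrightarrow> csign K' c = csign K c"
    "\<And>c. c \<in> G \<Longrightarrow> over_time K c \<notin> closed_arcs Is \<and> under_time K c \<notin> closed_arcs Is"
proof -
  obtain D where D: "meets_disc_in K D Is" "meets_disc_in K' D Is"
    using lc unfolding local_change_def by blast
  note lc' = local_change_sym[OF lc]
  let ?G = "{c \<in> classical_crossings K. c \<notin> interior D}"
  have out: "c \<in> classical_crossings K' \<and> over_time K' c = over_time K c \<and>
      under_time K' c = under_time K c \<and> over_time K c \<notin> closed_arcs Is \<and>
      under_time K c \<notin> closed_arcs Is" if "c \<in> ?G" for c
    using outer_crossing[OF lc D(1) classical_crossing_at[OF K], of c] that
      crossing_at_times[OF K', of c] by blast
  have "c \<in> ?G" if "c \<in> classical_crossings K'" "c \<notin> interior D" for c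
    using outer_crossing(1)[OF lc' D(2) classical_crossing_at[OF K' that(1)] that(2)]
      crossing_at_times(3)[OF K] that by blast
  then have G: "{c \<in> classical_crossings K'. c \<notin> interior D} = ?G" using out by blast
  have sg: "csign K' c = csign K c" if c: "c \<in> ?G" for c
  proof -
    have "over_time K c \<in> {0..<1} - closed_arcs Is" "under_time K c \<in> {0..<1} - closed_arcs Is"
      using out[OF c] classical_crossing_at[OF K, of c] c by (auto simp: crossing_at_def)
    then show ?thesis unfolding csign_def using out[OF c] local_change_derivative[OF K K' lc] by simp
  qed
  note dec = classical_crossings_decomposition[OF K lc tg D(1)]
    classical_crossings_decomposition[OF K' lc' tg' D(2), unfolded G]
  have disj: "?G \<inter> (\<lambda>(s, t). strand K s) ` C = {}" "?G \<inter> (\<lambda>(s, t). strand K' s) ` C' = {}"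
    using dec(2,4) by blast+
  show ?thesis
  proof (rule that[OF dec(1) disj(1) dec(3) disj(2)])
    fix c assume c: "c \<in> ?G"
    show "over_time K' c = over_time K c \<and> under_time K' c = under_time K c"
      "over_time K c \<notin> closed_arcs Is \<and> under_time K c \<notin> closed_arcs Is"
      using out[OF c] by blast+
    show "csign K' c = csign K c" by (rule sg[OF c])
  qed
qed

lemma same_writhes_outside:
  assumes "finite G"
    and "\<And>c. c \<in> G \<Longrightarrow> over_time K' c = over_time K c \<and> under_time K' c = under_time K c"
    and "\<And>c. c \<in> G \<Longrightarrow> csign K' c = csign K c"
  shows "same_writhes (linked K) (csign K) G (linked K') (csign K') G"
proof (rule same_writhes_iso[where f = id])
  show "linked K' (id x) (id y) \<longleftrightarrow> linked K x y" if "x \<in> G" "y \<in> G" for x y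
    using assms(2)[OF that(1)] assms(2)[OF that(2)] by (simp add: linked_def)
qed (use assms(1,3) in auto)

text \<open>Virtual crossings and bars do not enter the graph; this settles \<open>V1\<close>,
  \<open>V2\<close>, \<open>V3\<close>, \<open>T1\<close> and \<open>T2\<close>.\<close>

lemma local_change_without_classical:
  assumes K: "twisted_diagram K" and K': "twisted_diagram K'" and lc: "local_change K K' Is"
    and tg: "tangle K Is {} V B" and tg': "tangle K' Is {} V' B'"
  shows "equal_writhes K K'"
proof (rule local_change_crossings[OF K K' lc tg tg'])
  fix G
  assume cc: "classical_crossings K = G \<union> (\<lambda>(s, t). strand K s) ` {}"
      "classical_crossings K' = G \<union> (\<lambda>(s, t). strand K' s) ` {}"
    and out: "\<And>c. c \<in> G \<Longrightarrow> over_time K' c = over_time K c \<and> under_time K' c = under_time K c"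
      "\<And>c. c \<in> G \<Longrightarrow> csign K' c = csign K c"
  have "finite G" using cc(1) finite_classical_crossings[OF K] by simp
  from same_writhes_outside[OF this out] show ?thesis using cc by simp
qed

section \<open>Interlacement and arcs, and the moves with classical crossings\<close>

lemma less_outside_arc:
  assumes "x \<in> open_arc I" "y \<in> open_arc I" "I \<in> set Is" "u \<notin> closed_arcs Is"
  shows "x < u \<longleftrightarrow> y < u"
  using assms by (force simp: open_arc_def closed_arcs_def)

lemma less_disjoint_arcs:
  assumes "local_change K K' Is" "I \<in> set Is" "J \<in> set Is" "I \<noteq> J"
    and "x \<in> open_arc I" "x' \<in> open_arc I" "y \<in> open_arc J" "y' \<in> open_arc J"
  shows "x < y \<longleftrightarrow> x' < y'" "x \<noteq> y"
proof -
  have "disjnt {fst I..snd I} {fst J..snd J}" "fst I < snd I" "fst J < snd J"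
    using assms unfolding local_change_def pairwise_def by blast+
  then have "snd I < fst J \<or> snd J < fst I"
    by (smt (verit) atLeastAtMost_iff disjnt_iff)
  then show "x < y \<longleftrightarrow> x' < y'" "x \<noteq> y" using assms(5-) by (auto simp: open_arc_def)
qed

text \<open>A parameter off the closed arcs lies on the same side of all parameters of an arc, so
  only the arcs that carry the pair matter.\<close>

lemma interlaced_outside:
  assumes "s \<in> open_arc I" "s' \<in> open_arc I" "t \<in> open_arc J" "t' \<in> open_arc J"
    "I \<in> set Is" "J \<in> set Is" "u \<notin> closed_arcs Is" "v \<notin> closed_arcs Is"
  shows "interlaced s t u v \<longleftrightarrow> interlaced s' t' u v"
  using less_outside_arc[OF assms(1,2,5)] less_outside_arc[OF assms(3,4,6)] assms(7,8)
  unfolding interlaced_def by blast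

lemma interlaced_commute: "interlaced s t u v \<longleftrightarrow> interlaced t s u v"
  by (auto simp: interlaced_def)

text \<open>Both passages of the new crossing lie on one arc, so no parameter off the arc separates
  them and the new vertex is isolated.\<close>

lemma move_C1_writhes:
  assumes K: "twisted_diagram K" and K': "twisted_diagram K'" and mv: "move_C1 K K'"
  shows "equal_writhes K K'"
proof -
  obtain I s t where lc: "local_change K K' [I]"
    and tg: "tangle K [I] {} {} {}" and tg': "tangle K' [I] {(s, t)} {} {}"
    using mv unfolding move_C1_def by blast
  obtain G where G: "classical_crossings K = G" "classical_crossings K' = insert (strand K' s) G"
    "strand K' s \<notin> G"
    and out: "\<And>c. c \<in> G \<Longrightarrow> over_time K' c = over_time K c \<and> under_time K' c = under_time K c"
    "\<And>c. c \<in> G \<Longrightarrow> csign K' c = csign K c"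
    "\<And>c. c \<in> G \<Longrightarrow> over_time K c \<notin> closed_arcs [I] \<and> under_time K c \<notin> closed_arcs [I]"
    by (rule local_change_crossings[OF K K' lc tg tg']) auto
  have fG: "finite G" using G finite_classical_crossings[OF K] by simp
  have a: "crossing_at K' (strand K' s) s t"
    using tangle_crossing[OF local_change_sym[OF lc] tg'] by simp
  note tm = crossing_at_times[OF K' a]
  have "s \<in> open_arc I" "t \<in> open_arc I"
    using tangle_classical_iff[OF tg', of s t] by (auto simp: arc_params_def)
  then have "\<not> interlaced s t u v" if "u \<notin> closed_arcs [I]" "v \<notin> closed_arcs [I]" for u v
    using less_outside_arc[of s I t "[I]"] that unfolding interlaced_def by auto
  then have "\<not> linked K' (strand K' s) d" if "d \<in> G" for d
    using out(1,3) that unfolding linked_def tm by simp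
  moreover have "linked K' (strand K' s) d \<longleftrightarrow> linked K' d (strand K' s)" if "d \<in> G" for d
    by (rule linked_sym[OF K']) (use that G in auto)
  ultimately have "same_writhes (linked K') (csign K') G (linked K') (csign K') (insert (strand K' s) G)"
    by (intro same_writhes_isolated[OF fG G(3)]) auto
  with same_writhes_outside[OF fG out(1,2)] show ?thesis
    unfolding G(1,2) by (rule same_writhes_trans)
qed

text \<open>The over passages of the two new crossings share the arc \<open>I\<close> and the under
  passages share \<open>J\<close>, which makes the new vertices twins.\<close>

lemma move_C2_writhes:
  assumes K: "twisted_diagram K" and K': "twisted_diagram K'" and mv: "move_C2 K K'"
  shows "equal_writhes K K'"
proof -
  obtain I J s1 s2 t1 t2 where lc: "local_change K K' [I, J]"
    and arcs: "{s1, s2} \<subseteq> open_arc I" "{t1, t2} \<subseteq> open_arc J" "s1 \<noteq> s2"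
    and tg: "tangle K [I, J] {} {} {}" and tg': "tangle K' [I, J] {(s1, t1), (s2, t2)} {} {}"
    and sg: "csign K' (strand K' s1) = - csign K' (strand K' s2)"
    using mv unfolding move_C2_def by (elim exE conjE) (rule that)
  let ?a = "strand K' s1" and ?b = "strand K' s2"
  obtain G where G: "classical_crossings K = G" "classical_crossings K' = insert ?a (insert ?b G)"
    "?a \<notin> G" "?b \<notin> G"
    and out: "\<And>c. c \<in> G \<Longrightarrow> over_time K' c = over_time K c \<and> under_time K' c = under_time K c"
    "\<And>c. c \<in> G \<Longrightarrow> csign K' c = csign K c"
    "\<And>c. c \<in> G \<Longrightarrow> over_time K c \<notin> closed_arcs [I, J] \<and> under_time K c \<notin> closed_arcs [I, J]"
    by (rule local_change_crossings[OF K K' lc tg tg']) auto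
  have fG: "finite G" using G finite_classical_crossings[OF K] by simp
  have a: "crossing_at K' ?a s1 t1" and b: "crossing_at K' ?b s2 t2"
    using tangle_crossing[OF local_change_sym[OF lc] tg'] by simp_all
  note ta = crossing_at_times[OF K' a] and tb = crossing_at_times[OF K' b]
  have ne: "?a \<noteq> ?b"
  proof
    assume eq: "?a = ?b"
    from ta(1) tb(1) have "s1 = s2" unfolding eq by (rule trans[OF sym])
    with arcs(3) show False ..
  qed
  have ad: "linked K' ?a d \<longleftrightarrow> linked K' ?b d" if "d \<in> G" for d
    unfolding linked_def ta tb
    by (rule interlaced_outside[of _ I _ _ J _ "[I, J]"]) (use out(1,3)[OF that] arcs in simp_all)
  have tw: "(linked K' ?a d \<longleftrightarrow> linked K' ?b d) \<and> (linked K' d ?a \<longleftrightarrow> linked K' d ?b)"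
    if d: "d \<in> G" for d
  proof -
    have "linked K' ?a d \<longleftrightarrow> linked K' d ?a" "linked K' ?b d \<longleftrightarrow> linked K' d ?b"
      by (rule linked_sym[OF K']; use d G in blast)+
    then show ?thesis using ad[OF d] by blast
  qed
  have "linked K' ?a ?b \<longleftrightarrow> linked K' ?b ?a"
    by (rule linked_sym[OF K']) (use ne G in auto)
  from same_writhes_twins[where L = "linked K'" and \<sigma> = "csign K'", OF fG G(3,4) ne this tw sg]
  have "same_writhes (linked K') (csign K') G (linked K') (csign K') (insert ?a (insert ?b G))" .
  with same_writhes_outside[OF fG out(1,2)] show ?thesis
    unfolding G(1,2) by (rule same_writhes_trans)
qed

text \<open>\<open>V4\<close> and \<open>T3\<close> keep the two arcs of a single classical crossing and its sign; \<open>T3\<close> exchanges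
  over and under, which interlacement does not see.\<close>

lemma local_change_one_classical:
  assumes K: "twisted_diagram K" and K': "twisted_diagram K'" and lc: "local_change K K' Is"
    and tg: "tangle K Is {(s, t)} V B" and tg': "tangle K' Is {(s', t')} V' B'"
    and IJ: "I \<in> set Is" "J \<in> set Is"
    and arcs: "s \<in> open_arc I" "t \<in> open_arc J"
      "s' \<in> open_arc I \<and> t' \<in> open_arc J \<or> s' \<in> open_arc J \<and> t' \<in> open_arc I"
    and sg: "csign K' (strand K' s') = csign K (strand K s)"
  shows "equal_writhes K K'"
proof -
  let ?a = "strand K s" and ?b = "strand K' s'"
  obtain G where G: "classical_crossings K = insert ?a G" "?a \<notin> G"
    "classical_crossings K' = insert ?b G" "?b \<notin> G"
    and out: "\<And>c. c \<in> G \<Longrightarrow> over_time K' c = over_time K c \<and> under_time K' c = under_time K c"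
    "\<And>c. c \<in> G \<Longrightarrow> csign K' c = csign K c"
    "\<And>c. c \<in> G \<Longrightarrow> over_time K c \<notin> closed_arcs Is \<and> under_time K c \<notin> closed_arcs Is"
    by (rule local_change_crossings[OF K K' lc tg tg']) auto
  have a: "crossing_at K ?a s t" and b: "crossing_at K' ?b s' t'"
    using tangle_crossing[OF lc tg] tangle_crossing[OF local_change_sym[OF lc] tg'] by simp_all
  note ta = crossing_at_times[OF K a] and tb = crossing_at_times[OF K' b]
  have ad: "linked K' ?b d \<longleftrightarrow> linked K ?a d" if d: "d \<in> G" for d
    using arcs(3)
  proof
    assume "s' \<in> open_arc I \<and> t' \<in> open_arc J"
    then show ?thesis
      using out(1,3)[OF d] arcs IJ interlaced_outside[of s I s' t J t' Is]
      unfolding linked_def ta tb by simp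
  next
    assume "s' \<in> open_arc J \<and> t' \<in> open_arc I"
    then show ?thesis
      using out(1,3)[OF d] arcs IJ interlaced_outside[of s I t' t J s' Is]
      unfolding linked_def ta tb interlaced_commute[of s'] by simp
  qed
  have da: "linked K' d ?b \<longleftrightarrow> linked K d ?a" if d: "d \<in> G" for d
    using ad[OF d] linked_sym[OF K, of d ?a] linked_sym[OF K', of d ?b] G d by auto
  have bij: "bij_betw (id(?a := ?b)) (insert ?a G) (insert ?b G)"
    using G by (auto simp: bij_betw_def inj_on_def)
  have lk: "linked K' x y \<longleftrightarrow> linked K x y" if "x \<in> G" "y \<in> G" for x y
    using out(1) that by (simp add: linked_def)
  show ?thesis unfolding G
    by (rule same_writhes_iso[OF _ bij])
      (use finite_classical_crossings[OF K] G ad da lk out(2) sg in auto)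
qed

lemma move_V4_writhes:
  assumes K: "twisted_diagram K" and K': "twisted_diagram K'" and mv: "move_V4 K K'"
  shows "equal_writhes K K'"
proof -
  obtain I J L i1 i2 j1 j2 l1 l2 i1' i2' j1' j2' l1' l2' where
    tc: "triangle_change K K' I J L i1 i2 j1 j2 l1 l2 i1' i2' j1' j2' l1' l2'" and
    tg: "tangle K [I, J, L] {(j2, l2)} {(i1, j1), (i2, l1)} {}"
      "tangle K' [I, J, L] {(j2', l2')} {(i1', j1'), (i2', l1')} {}" and
    sg: "csign K' (strand K' j2') = csign K (strand K j2)"
    using mv unfolding move_V4_def by (elim exE conjE) (rule that)
  show ?thesis
    by (rule local_change_one_classical[OF K K' _ tg, of J L])
      (use tc sg in \<open>auto simp: triangle_change_def\<close>)
qed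

lemma move_T3_writhes:
  assumes K: "twisted_diagram K" and K': "twisted_diagram K'" and mv: "move_T3 K K'"
  shows "equal_writhes K K'"
proof -
  obtain I J s t s1 s2 t1 t2 s' t' v1 v2 w1 w2 where lc: "local_change K K' [I, J]"
    and arcs: "{s, s1, s2, s', v1, v2} \<subseteq> open_arc I" "{t, t1, t2, t', w1, w2} \<subseteq> open_arc J"
    and tg: "tangle K [I, J] {(s, t)} {} {s1, s2, t1, t2}"
      "tangle K' [I, J] {(t', s')} {(v1, w1), (v2, w2)} {}"
    and sg: "csign K' (strand K' s') = csign K (strand K s)"
    using mv unfolding move_T3_def by (elim exE conjE) (rule that)
  have "crossing_at K' (strand K' t') t' s'"
    using tangle_crossing(1)[OF local_change_sym[OF lc] tg(2), of t' s'] by simp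
  \<comment> \<open>The move states its sign condition at the passage \<open>s'\<close>, which is
    now the under one; the over passage \<open>t'\<close> is at the same point.\<close>
  then have "strand K' s' = strand K' t'" by (simp add: crossing_at_def)
  with sg have sg': "csign K' (strand K' t') = csign K (strand K s)" by (simp only:)
  show ?thesis
    by (rule local_change_one_classical[OF K K' lc tg _ _ _ _ _ sg', of I J]) (use arcs in simp_all)
qed

text \<open>The vertices \<open>?a\<close>, \<open>?b\<close>, \<open>?c\<close> are the crossings
  of \<open>I\<close> with \<open>J\<close>, of \<open>I\<close> with \<open>L\<close> and of
  \<open>J\<close> with \<open>L\<close>, so any two of them share exactly one arc.\<close>

lemma move_C3_writhes:
  assumes K: "twisted_diagram K" and K': "twisted_diagram K'" and mv: "move_C3 K K'"
  shows "equal_writhes K K'"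
proof -
  obtain I J L i1 i2 j1 j2 l1 l2 i1' i2' j1' j2' l1' l2' where
    tc: "triangle_change K K' I J L i1 i2 j1 j2 l1 l2 i1' i2' j1' j2' l1' l2'" and
    tg: "tangle K [I, J, L] {(i1, j1), (i2, l1), (j2, l2)} {} {}"
      "tangle K' [I, J, L] {(i1', j1'), (i2', l1'), (j2', l2')} {} {}" and
    sg: "csign K' (strand K' i1') = csign K (strand K i1)"
      "csign K' (strand K' i2') = csign K (strand K i2)"
      "csign K' (strand K' j2') = csign K (strand K j2)"
    using mv unfolding move_C3_def by (elim exE conjE) (rule that)
  let ?Is = "[I, J, L]"
  have lc: "local_change K K' ?Is"
    and arcs: "i1 \<in> open_arc I" "i2 \<in> open_arc I" "i1' \<in> open_arc I" "i2' \<in> open_arc I"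
      "j1 \<in> open_arc J" "j2 \<in> open_arc J" "j1' \<in> open_arc J" "j2' \<in> open_arc J"
      "l1 \<in> open_arc L" "l2 \<in> open_arc L" "l1' \<in> open_arc L" "l2' \<in> open_arc L"
    and rev: "i1 < i2 \<longleftrightarrow> i2' < i1'" "j1 < j2 \<longleftrightarrow> j2' < j1'" "l1 < l2 \<longleftrightarrow> l2' < l1'"
    using tc unfolding triangle_change_def by auto
  have dist: "I \<noteq> J" "I \<noteq> L" "J \<noteq> L" using lc unfolding local_change_def by auto
  let ?a = "strand K i1" and ?b = "strand K i2" and ?c = "strand K j2"
  let ?a' = "strand K' i1'" and ?b' = "strand K' i2'" and ?c' = "strand K' j2'"
  obtain G where G: "classical_crossings K = insert ?a (insert ?b (insert ?c G))"
    "?a \<notin> G" "?b \<notin> G" "?c \<notin> G"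
    "classical_crossings K' = insert ?a' (insert ?b' (insert ?c' G))"
    "?a' \<notin> G" "?b' \<notin> G" "?c' \<notin> G"
    and out: "\<And>c. c \<in> G \<Longrightarrow> over_time K' c = over_time K c \<and> under_time K' c = under_time K c"
    "\<And>c. c \<in> G \<Longrightarrow> csign K' c = csign K c"
    "\<And>c. c \<in> G \<Longrightarrow> over_time K c \<notin> closed_arcs ?Is \<and> under_time K c \<notin> closed_arcs ?Is"
    by (rule local_change_crossings[OF K K' lc tg]) auto
  note lIJ = less_disjoint_arcs[OF lc _ _ dist(1)] and lIL = less_disjoint_arcs[OF lc _ _ dist(2)]
    and lJL = less_disjoint_arcs[OF lc _ _ dist(3)]
  have cr: "crossing_at K ?a i1 j1" "crossing_at K ?b i2 l1" "crossing_at K ?c j2 l2"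
    "crossing_at K' ?a' i1' j1'" "crossing_at K' ?b' i2' l1'" "crossing_at K' ?c' j2' l2'"
    using tangle_crossing[OF lc tg(1)] tangle_crossing[OF local_change_sym[OF lc] tg(2)] by simp_all
  note tm = crossing_at_times[OF K cr(1)] crossing_at_times[OF K cr(2)] crossing_at_times[OF K cr(3)]
    crossing_at_times[OF K' cr(4)] crossing_at_times[OF K' cr(5)] crossing_at_times[OF K' cr(6)]
  have ne_arcs: "x \<noteq> y" "x \<noteq> z" "y \<noteq> z"
    if "x \<in> open_arc I" "y \<in> open_arc J" "z \<in> open_arc L" for x y z
    using lIJ(2)[of x x y y] lIL(2)[of x x z z] lJL(2)[of y y z z] that by auto
  have ne: "?a \<noteq> ?b" "?a \<noteq> ?c" "?b \<noteq> ?c" "?a' \<noteq> ?b'" "?a' \<noteq> ?c'" "?b' \<noteq> ?c'"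
    using ne_arcs arcs tm by metis+
  have neq: "i1 \<noteq> i2" "j1 \<noteq> j2" "l1 \<noteq> l2" "i1' \<noteq> i2'" "j1' \<noteq> j2'" "l1' \<noteq> l2'"
    using distinct_crossing_times[OF K _ _ ne(1)] distinct_crossing_times[OF K _ _ ne(2)]
      distinct_crossing_times[OF K _ _ ne(3)] distinct_crossing_times[OF K' _ _ ne(4)]
      distinct_crossing_times[OF K' _ _ ne(5)] distinct_crossing_times[OF K' _ _ ne(6)] tm by auto
  \<comment> \<open>Since the parameters are distinct, the reversal of the order becomes a
    negation.\<close>
  have rev': "i1' < i2' \<longleftrightarrow> \<not> i1 < i2" "j1' < j2' \<longleftrightarrow> \<not> j1 < j2" "l1' < l2' \<longleftrightarrow> \<not> l1 < l2"
    using rev neq by auto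
  \<comment> \<open>Of the four comparisons between two of these crossings, three involve different
    arcs and are unaffected; the fourth is the order on the shared arc, which the move
    reverses.\<close>
  have tog: "linked K' ?a' ?b' \<longleftrightarrow> \<not> linked K ?a ?b" "linked K' ?a' ?c' \<longleftrightarrow> \<not> linked K ?a ?c"
    "linked K' ?b' ?c' \<longleftrightarrow> \<not> linked K ?b ?c"
  proof -
    have less: "x < y \<longleftrightarrow> x' < y'" "x < z \<longleftrightarrow> x' < z'" "y < z \<longleftrightarrow> y' < z'"
        "y < x \<longleftrightarrow> y' < x'" "z < x \<longleftrightarrow> z' < x'" "z < y \<longleftrightarrow> z' < y'"
      if "x \<in> open_arc I" "x' \<in> open_arc I" "y \<in> open_arc J" "y' \<in> open_arc J"
        "z \<in> open_arc L" "z' \<in> open_arc L" for x x' y y' z z'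
      using less_disjoint_arcs(1)[OF lc _ _ dist(1) that(1-4)]
        less_disjoint_arcs(1)[OF lc _ _ dist(2) that(1,2,5,6)]
        less_disjoint_arcs(1)[OF lc _ _ dist(3) that(3-6)]
        less_disjoint_arcs(1)[OF lc _ _ dist(1)[symmetric] that(3,4,1,2)]
        less_disjoint_arcs(1)[OF lc _ _ dist(2)[symmetric] that(5,6,1,2)]
        less_disjoint_arcs(1)[OF lc _ _ dist(3)[symmetric] that(5,6,3,4)] by simp_all
    have ab: "j1 < i2 \<longleftrightarrow> j1' < i2'" "i1 < l1 \<longleftrightarrow> i1' < l1'" "j1 < l1 \<longleftrightarrow> j1' < l1'"
      and ac: "i1 < j2 \<longleftrightarrow> i1' < j2'" "i1 < l2 \<longleftrightarrow> i1' < l2'" "j1 < l2 \<longleftrightarrow> j1' < l2'"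
      and bc: "i2 < j2 \<longleftrightarrow> i2' < j2'" "l1 < j2 \<longleftrightarrow> l1' < j2'" "i2 < l2 \<longleftrightarrow> i2' < l2'"
      using less[of i1 i1' j1 j1' l1 l1'] less[of i2 i2' j1 j1' l1 l1'] less[of i1 i1' j2 j2' l2 l2']
        less[of i1 i1' j1 j1' l2 l2'] less[of i2 i2' j2 j2' l2 l2'] less[of i2 i2' j2 j2' l1 l1'] arcs
      by (simp_all only: True_implies_equals simp_thms)
    show "linked K' ?a' ?b' \<longleftrightarrow> \<not> linked K ?a ?b"
      unfolding linked_def tm interlaced_def ab rev'(1) by argo
    show "linked K' ?a' ?c' \<longleftrightarrow> \<not> linked K ?a ?c"
      unfolding linked_def tm interlaced_def ac rev'(2) by argo
    show "linked K' ?b' ?c' \<longleftrightarrow> \<not> linked K ?b ?c"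
      unfolding linked_def tm interlaced_def bc rev'(3) by argo
  qed
  have od: "linked K' ?a' d \<longleftrightarrow> linked K ?a d" "linked K' ?b' d \<longleftrightarrow> linked K ?b d"
    "linked K' ?c' d \<longleftrightarrow> linked K ?c d" "linked K ?a d \<longleftrightarrow> (linked K ?b d \<noteq> linked K ?c d)"
    if d: "d \<in> G" for d
  proof -
    define u v where "u = over_time K d" and "v = under_time K d"
    have uv: "u \<notin> closed_arcs ?Is" "v \<notin> closed_arcs ?Is" using out(3)[OF d] by (auto simp: u_def v_def)
    have tm': "over_time K' d = u" "under_time K' d = v" "over_time K d = u" "under_time K d = v"
      using out(1)[OF d] by (auto simp: u_def v_def)
    show "linked K' ?a' d \<longleftrightarrow> linked K ?a d"
      unfolding linked_def tm tm'
      by (rule interlaced_outside[of _ I _ _ J _ ?Is]) (use arcs uv in simp_all)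
    show "linked K' ?b' d \<longleftrightarrow> linked K ?b d"
      unfolding linked_def tm tm'
      by (rule interlaced_outside[of _ I _ _ L _ ?Is]) (use arcs uv in simp_all)
    show "linked K' ?c' d \<longleftrightarrow> linked K ?c d"
      unfolding linked_def tm tm'
      by (rule interlaced_outside[of _ J _ _ L _ ?Is]) (use arcs uv in simp_all)
    \<comment> \<open>Modulo 2, interlacement with \<open>d\<close> is a sum of one contribution per
      arc. In the sum for \<open>?b\<close> and \<open>?c\<close> the arc \<open>L\<close> occurs
      twice, which leaves \<open>I\<close> and \<open>J\<close>.\<close>
    show "linked K ?a d \<longleftrightarrow> (linked K ?b d \<noteq> linked K ?c d)"
      using less_outside_arc[of i1 I i2 ?Is] less_outside_arc[of j1 J j2 ?Is]
        less_outside_arc[of l1 L l2 ?Is] arcs uv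
      unfolding linked_def tm tm' interlaced_def by auto
  qed
  have fin: "finite G" using finite_classical_crossings[OF K] G(1) by simp
  show ?thesis unfolding G(1,5)
  proof (rule same_writhes_triangle[OF fin G(2-4) ne(1-3) G(6-8) ne(4-6)])
    show "linked K x y \<longleftrightarrow> linked K y x"
      if "x \<in> insert ?a (insert ?b (insert ?c G))" "y \<in> insert ?a (insert ?b (insert ?c G))" "x \<noteq> y"
      for x y by (rule linked_sym[OF K, unfolded G(1), OF that])
    show "linked K' x y \<longleftrightarrow> linked K' y x"
      if "x \<in> insert ?a' (insert ?b' (insert ?c' G))" "y \<in> insert ?a' (insert ?b' (insert ?c' G))"
        "x \<noteq> y"
      for x y by (rule linked_sym[OF K', unfolded G(5), OF that])
    show "linked K' d e \<longleftrightarrow> linked K d e" if "d \<in> G" "e \<in> G" for d e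
      using out(1)[OF that(1)] out(1)[OF that(2)] by (simp add: linked_def)
  qed (fact tog od sg | rule out(2) od, assumption)+
qed

section \<open>Knot types\<close>

lemma elementary_step_writhes:
  assumes "elementary_step K K'"
  shows "equal_writhes K K'"
proof -
  have K: "twisted_diagram K" and K': "twisted_diagram K'"
    using assms by (auto simp: elementary_step_def)
  consider "planar_isotopic K K'" | "reparametrized K K'" | "move_C1 K K'" | "move_C2 K K'"
    | "move_C3 K K'" | "move_V1 K K'" | "move_V2 K K'" | "move_V3 K K'" | "move_V4 K K'"
    | "move_T1 K K'" | "move_T2 K K'" | "move_T3 K K'"
    using assms unfolding elementary_step_def by blast
  then show ?thesis
  proof cases
    case 1
    then show ?thesis by (rule planar_isotopic_writhes[OF K K'])
  next
    case 2
    then show ?thesis by (rule reparametrized_writhes[OF K K'])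
  next
    case 3
    then show ?thesis by (rule move_C1_writhes[OF K K'])
  next
    case 4
    then show ?thesis by (rule move_C2_writhes[OF K K'])
  next
    case 5
    then show ?thesis by (rule move_C3_writhes[OF K K'])
  next
    case 6
    then show ?thesis unfolding move_V1_def
      by (elim exE conjE) (rule local_change_without_classical[OF K K'])
  next
    case 7
    then show ?thesis unfolding move_V2_def
      by (elim exE conjE) (rule local_change_without_classical[OF K K'])
  next
    case 8
    then show ?thesis unfolding move_V3_def triangle_change_def
      by (elim exE conjE) (rule local_change_without_classical[OF K K'])
  next
    case 9
    then show ?thesis by (rule move_V4_writhes[OF K K'])
  next
    case 10
    then show ?thesis unfolding move_T1_def
      by (elim exE conjE) (rule local_change_without_classical[OF K K'])
  next
    case 11
    then show ?thesis unfolding move_T2_def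
      by (elim exE conjE) (rule local_change_without_classical[OF K K'])
  next
    case 12
    then show ?thesis by (rule move_T3_writhes[OF K K'])
  qed
qed

text \<open>Each move is written in one direction only; \<open>equivclp\<close> supplies the
  inverses, which the symmetry of \<open>same_writhes\<close> absorbs.\<close>

lemma equal_writhes_if_same_knot_type:
  assumes "equivclp elementary_step K K'"
  shows "equal_writhes K K'"
  using assms
proof (induction rule: equivclp_induct)
  case base
  show ?case by (simp add: same_writhes_def)
next
  case (step J J')
  then have "equal_writhes J J'"
    using elementary_step_writhes same_writhes_sym by blast
  with step.IH show ?case by (rule same_writhes_trans)
qed

theorem theorem6p6:
  fixes K :: tdiagram
  assumes "twisted_diagram K"
    and "\<And>c. c \<in> classical_crossings K \<Longrightarrow>
           c \<notin> zero_crossings K \<or> (c \<in> zero_crossings K \<and> odd (zind 0 c K))"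
  shows "\<not> admits_cosmetic_crossing_change K"
proof
  assume "admits_cosmetic_crossing_change K"
  then obtain c where c: "c \<in> classical_crossings K"
    and kt: "knot_type (crossing_change K c) = knot_type K"
    by (auto simp: admits_cosmetic_crossing_change_def cosmetic_crossing_def)
  \<comment> \<open>By reflexivity, equality of the two classes makes the diagrams themselves
    equivalent.\<close>
  have "crossing_change K c \<in> knot_type (crossing_change K c)"
    by (simp add: knot_type_def)
  then have "equivclp elementary_step K (crossing_change K c)"
    unfolding kt by (simp add: knot_type_def)
  then have "equal_writhes K (crossing_change K c)"
    by (rule equal_writhes_if_same_knot_type)
  moreover have "\<not> equal_writhes K (crossing_change K c)"
    using assms(2)[OF c] by (intro crossing_change_writhes[OF assms(1) c]) auto
  ultimately show False by contradiction
qed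

end
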